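(* Let $L>0$ and let $\mathcal D=\{t\in\mathbb C:\ \mathrm{dist}(t,[0,T])\le r\}$ for some $r>0$ and $T>0$. If $f_0(t)$ is analytic in $\mathcal D$, then the series $$\sum_{n=1}^\infty A_{2n-1}(t)\,(x-L)^{2n-1},\qquad A_{2n-1}(t)=\frac{2(-1)^n}{\pi(2n-1)!}\int_0^tds\,f_0(s)\int_{\partial\Omega}k^{2n}\,\frac{e^{ikL}}{e^{2ikL}-1}\,e^{-k^2(t-s)}\,dk,$$ is entire in $x$ (i.e. it converges for all $x\in\mathbb C$ and defines an entire function of $x$) for $0\le t\le T$.
   Context: $\Omega=\{k\in\mathbb C:\ |k|>R,\ \pi/4<\mathrm{Arg}(k)<3\pi/4\}$ for some fixed $R>0$, with $\partial\Omega$ oriented with $\Omega$ on its left (from $\infty e^{3\pi i/4}$ to $\infty e^{i\pi/4}$). "Analytic in $\mathcal D$" means analytic on a neighbourhood of the closed set $\mathcal D$. The series is the Taylor series about $x=L$ of $$I_{f_0}(x,t)=\frac1{i\pi}\int_0^tds\,f_0(s)\int_{\partial\Omega}k\,\frac{\sin(k(L-x))}{\sin(kL)}\,e^{-k^2(t-s)}\,dk,\qquad 0<x<2L,$$ the boundary contribution at $x=0$ to the solution of the heat equation $u_t=u_{xx}$ on $(0,L)$ with Dirichlet data $u(0,t)=f_0(t)$; its even-power coefficients vanish. *)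

theory Defs
  imports "HOL-Complex_Analysis.Complex_Analysis"
begin

definition Omega :: "real \<Rightarrow> complex set" where
  "Omega R = {k. cmod k > R \<and> pi / 4 < Arg k \<and> Arg k < 3 * pi / 4}"

text \<open>
  The boundary of \<^term>\<open>Omega R\<close> consists of two rays and a circular arc (see
  \<open>frontier_Omega\<close> below).  With the region on its left it is traversed inwards along the ray at
  angle \<open>3\<pi>/4\<close>, then clockwise along the arc, then outwards along the ray at angle \<open>\<pi>/4\<close>.
  The integrals over the two unbounded rays are separate Lebesgue integrals, so no symmetric
  truncation at infinity is involved.
\<close>
definition ray_integral :: "real \<Rightarrow> real \<Rightarrow> (complex \<Rightarrow> complex) \<Rightarrow> complex" where
  "ray_integral R \<theta> g = (LBINT \<rho>:{R..}. g (of_real \<rho> * cis \<theta>) * cis \<theta>)"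

definition bdOmega_integral :: "real \<Rightarrow> (complex \<Rightarrow> complex) \<Rightarrow> complex" where
  "bdOmega_integral R g =
     - ray_integral R (3 * pi / 4) g
     + contour_integral (part_circlepath 0 R (3 * pi / 4) (pi / 4)) g
     + ray_integral R (pi / 4) g"

definition tube :: "real \<Rightarrow> real \<Rightarrow> complex set" where
  "tube T r = {t. infdist t (complex_of_real ` {0..T}) \<le> r}"

text \<open>\<open>coeff_A L R f\<^sub>0 n t\<close> is the coefficient \<open>A\<^bsub>2n-1\<^esub>(t)\<close>; it is meant for \<open>n \<ge> 1\<close> only.\<close>
definition coeff_A ::
    "real \<Rightarrow> real \<Rightarrow> (complex \<Rightarrow> complex) \<Rightarrow> nat \<Rightarrow> real \<Rightarrow> complex" where
  "coeff_A L R f\<^sub>0 n t =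
     2 * (-1) ^ n / (of_real pi * fact (2 * n - 1)) *
     (LBINT s:{0..t}. f\<^sub>0 (of_real s) *
        bdOmega_integral R (\<lambda>k.
          k ^ (2 * n) * (exp (\<i> * k * of_real L) / (exp (2 * \<i> * k * of_real L) - 1)) *
          exp (- (k ^ 2) * of_real (t - s))))"

lemma Arg_between_iff:
  assumes "k \<noteq> 0"
  shows "(pi / 4 < Arg k \<and> Arg k < 3 * pi / 4) \<longleftrightarrow> \<bar>Re k\<bar> < Im k"
proof -
  define a where "a = Arg k"
  have a: "- pi < a" "a \<le> pi" using Arg_bounded[of k] by (auto simp: a_def)
  have k: "k = rcis (cmod k) a" by (simp add: a_def rcis_cmod_Arg)
  have pos: "cmod k > 0" using assms by simp
  have "Re k = cmod k * cos a" "Im k = cmod k * sin a"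
    by (subst k; simp)+
  hence "\<bar>Re k\<bar> < Im k \<longleftrightarrow> \<bar>cos a\<bar> < sin a"
    using pos by (simp add: abs_mult)
  also have "\<dots> \<longleftrightarrow> sin a - cos a > 0 \<and> sin a + cos a > 0" by linarith
  also have "sin a - cos a = sqrt 2 * sin (a - pi / 4)"
    unfolding sin_diff sin_45 cos_45 by (simp add: algebra_simps)
  also have "sin a + cos a = sqrt 2 * sin (a + pi / 4)"
    unfolding sin_add sin_45 cos_45 by (simp add: algebra_simps)
  also have "sqrt 2 * sin (a - pi / 4) > 0 \<and> sqrt 2 * sin (a + pi / 4) > 0 \<longleftrightarrow>
      sin (a - pi / 4) > 0 \<and> sin (a + pi / 4) > 0" by (simp add: zero_less_mult_iff)
  also have "\<dots> \<longleftrightarrow> pi / 4 < a \<and> a < 3 * pi / 4"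
  proof
    assume "pi / 4 < a \<and> a < 3 * pi / 4"
    thus "sin (a - pi / 4) > 0 \<and> sin (a + pi / 4) > 0"
      by (intro conjI sin_gt_zero) auto
  next
    assume s: "sin (a - pi / 4) > 0 \<and> sin (a + pi / 4) > 0"
    have 1: "a > - pi / 4"
    proof (rule ccontr)
      assume "\<not> a > - pi / 4"
      hence "sin (- (a + pi / 4)) \<ge> 0" using a by (intro sin_ge_zero) auto
      thus False using s unfolding sin_minus by linarith
    qed
    have 2: "a < 3 * pi / 4"
    proof (rule ccontr)
      assume "\<not> a < 3 * pi / 4"
      hence "sin (a + pi / 4 - pi) \<ge> 0" using a by (intro sin_ge_zero) auto
      moreover have "sin (a + pi / 4 - pi) = - sin (a + pi / 4)"
        by (simp only: sin_diff cos_pi sin_pi)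
      ultimately show False using s by linarith
    qed
    have 3: "a > pi / 4"
    proof (rule ccontr)
      assume "\<not> a > pi / 4"
      hence "sin (- (a - pi / 4)) \<ge> 0" using 1 by (intro sin_ge_zero) auto
      thus False using s unfolding sin_minus by linarith
    qed
    show "pi / 4 < a \<and> a < 3 * pi / 4" using 2 3 by simp
  qed
  finally show ?thesis by (simp add: a_def)
qed

lemma Omega_eq:
  assumes "R > 0"
  shows "Omega R = {k. cmod k > R \<and> \<bar>Re k\<bar> < Im k}"
proof (intro set_eqI)
  fix k
  have "k \<noteq> 0" if "cmod k > R" using that assms by auto
  thus "k \<in> Omega R \<longleftrightarrow> k \<in> {k. cmod k > R \<and> \<bar>Re k\<bar> < Im k}"
    unfolding Omega_def mem_Collect_eq using Arg_between_iff[of k] by blast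
qed

lemma closure_Omega:
  assumes "R > 0"
  shows "closure (Omega R) = {k. cmod k \<ge> R \<and> \<bar>Re k\<bar> \<le> Im k}"
proof
  have "closed {k. cmod k \<ge> R \<and> \<bar>Re k\<bar> \<le> Im k}"
    by (intro closed_Collect_conj closed_Collect_le continuous_intros)
  thus "closure (Omega R) \<subseteq> {k. cmod k \<ge> R \<and> \<bar>Re k\<bar> \<le> Im k}"
    by (intro closure_minimal) (auto simp: Omega_eq[OF assms])
next
  show "{k. cmod k \<ge> R \<and> \<bar>Re k\<bar> \<le> Im k} \<subseteq> closure (Omega R)"
  proof
    fix k :: complex
    assume k: "k \<in> {k. cmod k \<ge> R \<and> \<bar>Re k\<bar> \<le> Im k}"
    show "k \<in> closure (Omega R)"
      unfolding closure_approachable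
    proof (intro allI impI)
      fix e :: real assume e: "e > 0"
      define y where "y = k + \<i> * of_real (e / 2)"
      have "(Im k)^2 < (Im k + e / 2)^2"
        using k e by (intro power_strict_mono) auto
      hence "cmod k < cmod y"
        unfolding cmod_def y_def by simp
      moreover have "\<bar>Re y\<bar> < Im y" using k e by (auto simp: y_def)
      ultimately have "y \<in> Omega R" using k by (auto simp: Omega_eq[OF assms])
      moreover have "dist y k < e" using e by (simp add: y_def dist_norm norm_mult)
      ultimately show "\<exists>y\<in>Omega R. dist y k < e" by blast
    qed
  qed
qed

lemma mem_frontier_Omega_iff:
  assumes "R > 0"
  shows "k \<in> frontier (Omega R) \<longleftrightarrow>
    cmod k \<ge> R \<and> \<bar>Re k\<bar> \<le> Im k \<and> (cmod k = R \<or> \<bar>Re k\<bar> = Im k)"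
proof -
  have "open {k. cmod k > R \<and> \<bar>Re k\<bar> < Im k}"
    by (intro open_Collect_conj open_Collect_less continuous_intros)
  hence "open (Omega R)"
    unfolding Omega_eq[OF assms] .
  hence int: "interior (Omega R) = Omega R"
    by (rule interior_open)
  have mem: "k \<in> Omega R \<longleftrightarrow> cmod k > R \<and> \<bar>Re k\<bar> < Im k"
    unfolding Omega_eq[OF assms] by simp
  show ?thesis
    unfolding frontier_def int closure_Omega[OF assms] Diff_iff mem mem_Collect_eq by linarith
qed

lemma sqrt_2_half: "sqrt 2 * x * (sqrt 2 / 2) = x"
proof -
  have "sqrt 2 * x * (sqrt 2 / 2) = (sqrt 2 * sqrt 2) * x / 2"
    by (simp only: times_divide_eq_right mult.assoc mult.commute mult.left_commute)
  thus ?thesis by simp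
qed

lemma cmod_diagonal:
  assumes "\<bar>Re k\<bar> = Im k"
  shows "cmod k = sqrt 2 * Im k"
proof -
  have "(Re k)^2 = (Im k)^2" using assms by (metis power2_abs)
  hence "cmod k = sqrt (2 * (Im k)^2)" unfolding cmod_def by simp
  moreover have "Im k \<ge> 0" using assms by linarith
  ultimately show ?thesis by (simp add: real_sqrt_mult)
qed

lemma cis_45: "cis (pi / 4) = Complex (sqrt 2 / 2) (sqrt 2 / 2)"
  by (simp add: cis.code cos_45 sin_45)

lemma cis_135: "cis (3 * pi / 4) = Complex (- (sqrt 2 / 2)) (sqrt 2 / 2)"
proof -
  have "3 * pi / 4 = pi - pi / 4" by simp
  thus ?thesis by (simp only: cis.code cos_pi_minus sin_pi_minus cos_45 sin_45)
qed

lemma on_ray: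
  assumes "\<bar>Re k\<bar> = Im k"
  shows "k = of_real (cmod k) * cis (pi / 4) \<or> k = of_real (cmod k) * cis (3 * pi / 4)"
proof (cases "Re k \<ge> 0")
  case True
  hence "Re k = Im k" using assms by linarith
  hence "k = of_real (cmod k) * cis (pi / 4)"
    unfolding cmod_diagonal[OF assms] cis_45
    using sqrt_2_half[of "Im k"] by (intro complex_eqI) simp_all
  thus ?thesis ..
next
  case False
  hence "Re k = - Im k" using assms by linarith
  hence "k = of_real (cmod k) * cis (3 * pi / 4)"
    unfolding cmod_diagonal[OF assms] cis_135
    using sqrt_2_half[of "Im k"] by (intro complex_eqI) simp_all
  thus ?thesis ..
qed

lemma ray_subset_frontier_Omega:
  assumes "R > 0" "\<rho> \<ge> R"
  shows "of_real \<rho> * cis (pi / 4) \<in> frontier (Omega R)"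
    and "of_real \<rho> * cis (3 * pi / 4) \<in> frontier (Omega R)"
proof -
  have "\<bar>cos (pi / 4)\<bar> = sin (pi / 4)" "\<bar>cos (3 * pi / 4)\<bar> = sin (3 * pi / 4)"
    using arg_cong[OF cis_45, of Re] arg_cong[OF cis_45, of Im]
      arg_cong[OF cis_135, of Re] arg_cong[OF cis_135, of Im]
    real_sqrt_ge_zero[of 2]
    unfolding cis.sel complex.sel by linarith+
  moreover have "\<rho> > 0" using assms by linarith
  ultimately show "of_real \<rho> * cis (pi / 4) \<in> frontier (Omega R)"
    "of_real \<rho> * cis (3 * pi / 4) \<in> frontier (Omega R)"
    using assms(2)
    by (simp_all add: mem_frontier_Omega_iff[OF assms(1)] norm_mult abs_mult)
qed

lemma frontier_Omega:
  assumes "R > 0"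
  shows "frontier (Omega R) =
    (\<lambda>\<rho>. of_real \<rho> * cis (3 * pi / 4)) ` {R..} \<union>
    path_image (part_circlepath 0 R (3 * pi / 4) (pi / 4)) \<union>
    (\<lambda>\<rho>. of_real \<rho> * cis (pi / 4)) ` {R..}"
  (is "_ = ?A \<union> ?B \<union> ?C")
proof (intro equalityI subsetI)
  have B: "?B = (\<lambda>a. rcis R a) ` {pi / 4..3 * pi / 4}"
    by (simp add: path_image_part_circlepath' closed_segment_eq_real_ivl rcis_def)
  {
    fix k assume "k \<in> frontier (Omega R)"
    hence k: "cmod k \<ge> R" "\<bar>Re k\<bar> \<le> Im k" "cmod k = R \<or> \<bar>Re k\<bar> = Im k"
      unfolding mem_frontier_Omega_iff[OF assms] by blast+
    show "k \<in> ?A \<union> ?B \<union> ?C"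
    proof (cases "\<bar>Re k\<bar> = Im k")
      case True
      thus ?thesis using on_ray[OF True] k(1) by blast
    next
      case False
      hence R: "cmod k = R" and lt: "\<bar>Re k\<bar> < Im k" using k by auto
      have "k \<noteq> 0" using R assms by auto
      hence "Arg k \<in> {pi / 4..3 * pi / 4}" using lt Arg_between_iff[of k] by simp
      moreover have "k = rcis R (Arg k)" using rcis_cmod_Arg[of k] unfolding R by (rule sym)
      ultimately show ?thesis unfolding B by blast
    qed
  next
    fix k assume "k \<in> ?A \<union> ?B \<union> ?C"
    then consider "k \<in> ?A \<union> ?C" | a where "pi / 4 \<le> a" "a \<le> 3 * pi / 4" "k = rcis R a"
      unfolding B by auto
    thus "k \<in> frontier (Omega R)"
    proof cases
      case 1
      thus ?thesis using ray_subset_frontier_Omega[OF assms] by auto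
    next
      case 2
      have "a \<in> {-pi<..pi}" using 2(1,2) pi_gt_zero unfolding greaterThanAtMost_iff by linarith
      hence Arg: "Arg k = a" using 2(3) assms by (intro Arg_unique'[of R])
      have R: "cmod k = R" using 2 assms by simp
      consider "a = pi / 4" | "a = 3 * pi / 4" | "pi / 4 < a \<and> a < 3 * pi / 4"
        using 2 by linarith
      thus ?thesis
      proof cases
        case 3
        moreover have "k \<noteq> 0" using R assms by auto
        ultimately have "\<bar>Re k\<bar> < Im k" using Arg_between_iff[of k] Arg by blast
        thus ?thesis unfolding mem_frontier_Omega_iff[OF assms] using R by simp
      qed (use 2(3) ray_subset_frontier_Omega[OF assms order.refl] in
          \<open>simp_all only: rcis_def\<close>)
    qed
  }
qed

end

theory Submission
  imports Defs "HOL-Probability.Sinc_Integral"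
begin

text \<open>
  Write \<open>K\<^sub>n(\<tau>)\<close> for the inner integral over the boundary of \<^term>\<open>Omega R\<close>, so that \<open>K\<^sub>n' = -K\<^sub>n\<^sub>+\<^sub>1\<close>.
  At \<open>\<tau> = 0\<close> the contour can be pushed up to \<open>\<i>\<infinity>\<close>, where the integrand decays exponentially,
  hence \<open>K\<^sub>n(0) = 0\<close>.  At \<open>\<tau> = t > 0\<close> the two rays can be lowered to the directions
  \<open>\<plusminus>2 + \<i>\<close>, along which \<open>exp (-k\<^sup>2t)\<close> has Gaussian decay, hence
  \<open>\<bar>K\<^sub>n(t)\<bar> \<le> C n! M\<^sup>n\<close>.  Integrating \<open>\<integral> f\<^sub>0(s) K\<^sub>n(t - s) ds\<close> by parts \<open>n\<close> times, the boundary terms at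
  \<open>s = t\<close> vanish, those at \<open>s = 0\<close> are products of Taylor data of \<open>f\<^sub>0\<close> with \<open>K\<^sub>m(t)\<close>, and Cauchy's
  inequality for \<open>f\<^sub>0\<close> bounds everything by \<open>C (n + 1) n! M\<^sup>n\<close>.  Divided by \<open>(2n - 1)!\<close> this still
  decays faster than any geometric sequence.
\<close>

section \<open>Integrals along rays and along the boundary of the sector\<close>

text \<open>
  All contour deformations take place in the upper half plane, which is convex, so a primitive of
  the integrand replaces the closed-contour form of Cauchy's theorem.
\<close>

lemma ray_integral_primitive:
  fixes G g :: "complex \<Rightarrow> complex"
  assumes "R > 0" "0 < sin \<theta>"
    and G: "\<And>z. Im z > 0 \<Longrightarrow> (G has_field_derivative g z) (at z)"
    and cont: "continuous_on {z. Im z > 0} g"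
    and B: "\<And>\<rho>. \<rho> \<ge> R \<Longrightarrow> norm (g (of_real \<rho> * cis \<theta>)) \<le> B / (1 + \<rho>\<^sup>2)"
  shows "((\<lambda>S. G (of_real S * cis \<theta>)) \<longlongrightarrow> G (of_real R * cis \<theta>) + ray_integral R \<theta> g) at_top"
proof -
  define f where "f = (\<lambda>\<rho>. g (of_real \<rho> * cis \<theta>) * cis \<theta>)"
  have Im: "Im (of_real \<rho> * cis \<theta>) > 0" if "\<rho> \<ge> R" for \<rho>
    using that assms by simp
  have contf: "continuous_on {R..} f"
    unfolding f_def
    by (intro continuous_intros continuous_on_compose2[OF cont]) (use Im in auto)
  have *: "set_integrable lborel {R..} (\<lambda>\<rho>::real. B * inverse (1 + \<rho>\<^sup>2))"
    by (rule set_integrable_mult_right, rule set_integrable_subset)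
       (use integrable_inverse_1_plus_square in \<open>auto simp: einterval_def\<close>)
  have int: "set_integrable lborel {R..} f"
  proof (rule set_integrable_bound[OF *])
    show "set_borel_measurable lborel {R..} f"
      unfolding set_borel_measurable_def using borel_measurable_continuous_on_indicator[OF _ contf] by simp
    have "norm (f x) \<le> norm (B * inverse (1 + x\<^sup>2))" if "x \<ge> R" for x
    proof -
      have "norm (f x) \<le> B / (1 + x\<^sup>2)" using B[OF that] by (simp add: f_def norm_mult)
      also have "\<dots> \<le> norm (B * inverse (1 + x\<^sup>2))" by (simp add: divide_inverse)
      finally show ?thesis .
    qed
    thus "AE x in lborel. x \<in> {R..} \<longrightarrow> norm (f x) \<le> norm (B * inverse (1 + x\<^sup>2))" by simp
  qed
  \<comment> \<open>Integrability of \<open>f\<close> makes the ray integral a limit of integrals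
    over bounded intervals, and on each of these the fundamental theorem yields an increment of
    \<open>G\<close>. Convergence of \<open>G\<close> along the ray comes out as a
    by-product.\<close>
  have "((\<lambda>S. G (of_real R * cis \<theta>) + (LBINT \<rho>:{R..S}. f \<rho>)) \<longlongrightarrow>
      G (of_real R * cis \<theta>) + (LBINT \<rho>:{R..}. f \<rho>)) at_top"
    by (intro tendsto_intros tendsto_set_lebesgue_integral_at_top int) auto
  moreover have "eventually (\<lambda>S. G (of_real R * cis \<theta>) + (LBINT \<rho>:{R..S}. f \<rho>) = G (of_real S * cis \<theta>)) at_top"
    using eventually_ge_at_top[of R]
  proof eventually_elim
    case (elim S)
    have "(f has_integral (G (of_real S * cis \<theta>) - G (of_real R * cis \<theta>))) {R..S}"
    proof (rule fundamental_theorem_of_calculus[OF elim])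
      fix x assume "x \<in> {R..S}"
      hence "Im (of_real x * cis \<theta>) > 0" using Im by simp
      note G[OF this]
      moreover have "((\<lambda>\<rho>. of_real \<rho> * cis \<theta>) has_vector_derivative cis \<theta>) (at x)"
        by (auto intro!: derivative_eq_intros)
      ultimately have "((\<lambda>S. G (of_real S * cis \<theta>)) has_vector_derivative cis \<theta> * g (of_real x * cis \<theta>)) (at x)"
        using field_vector_diff_chain_at unfolding o_def by blast
      thus "((\<lambda>S. G (of_real S * cis \<theta>)) has_vector_derivative f x) (at x within {R..S})"
        unfolding f_def by (simp add: has_vector_derivative_at_within mult.commute)
    qed
    moreover have "set_integrable lborel {R..S} f"
      by (rule set_integrable_subset[OF int]) auto
    ultimately show ?case
      by (simp add: set_borel_integral_eq_integral(2) integral_unique)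
  qed
  ultimately show ?thesis
    unfolding ray_integral_def f_def[symmetric] by (rule Lim_transform_eventually)
qed

text \<open>From here on points are written s(a + i): s is the height and a the horizontal slope, so
  the two rays are a = 1 and a = -1. Other rays and horizontal segments then share the same
  parametrisation.\<close>

lemma scaled_cis_45: "of_real S * cis (pi / 4) = of_real (S / sqrt 2) * Complex 1 1"
  and scaled_cis_135: "of_real S * cis (3 * pi / 4) = of_real (S / sqrt 2) * Complex (- 1) 1"
  using real_div_sqrt[of 2] unfolding cis_45 cis_135 by (simp_all add: complex_eq_iff field_simps)

text \<open>The three pieces telescope: the increment of \<open>G\<close> over the arc cancels the
  values of \<open>G\<close> at the starting points of the rays. Only the behaviour of
  \<open>G\<close> at the two ends remains, compared at equal height. The number
  \<open>R / sqrt 2\<close> is the height at which the rays start.\<close>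

lemma bdOmega_integral_primitive:
  fixes G g :: "complex \<Rightarrow> complex"
  assumes "R > 0"
    and G: "\<And>z. Im z > 0 \<Longrightarrow> (G has_field_derivative g z) (at z)"
    and cont: "continuous_on {z. Im z > 0} g"
    and B: "\<And>s a. s \<ge> R / sqrt 2 \<Longrightarrow> \<bar>a\<bar> = 1 \<Longrightarrow> norm (g (of_real s * Complex a 1)) \<le> B / (1 + s\<^sup>2)"
  shows "((\<lambda>S. G (of_real S * Complex 1 1) - G (of_real S * Complex (- 1) 1)) \<longlongrightarrow>
    bdOmega_integral R g) at_top"
proof -
  have B0: "B \<ge> 0"
  proof -
    have "0 \<le> B / (1 + (R / sqrt 2)\<^sup>2)"
      by (rule order.trans[OF norm_ge_zero B[of "R / sqrt 2" 1]]) auto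
    moreover have "1 + (R / sqrt 2)\<^sup>2 > 0" by (simp add: add_pos_nonneg)
    ultimately show ?thesis by (simp only: zero_le_divide_iff) linarith
  qed
  \<comment> \<open>The hypothesis bounds \<open>g\<close> in terms of the height \<rho> / sqrt 2,
    the ray integral needs a bound in terms of the modulus \<rho>; a factor 2 pays for the
    change.\<close>
  have bd: "B / (1 + (\<rho> / sqrt 2)\<^sup>2) \<le> 2 * B / (1 + \<rho>\<^sup>2)" for \<rho>
  proof -
    have "B / (1 + (\<rho> / sqrt 2)\<^sup>2) = 2 * B / (2 + \<rho>\<^sup>2)" 
      by (simp add: power_divide field_simps)
    also have "\<dots> \<le> 2 * B / (1 + \<rho>\<^sup>2)"
      using B0 by (intro divide_left_mono mult_pos_pos) (auto intro: add_pos_nonneg)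
    finally show ?thesis .
  qed
  have s: "sin (pi / 4) > 0" "sin (3 * pi / 4) > 0"
    by (intro sin_gt_zero; simp)+
  have r1: "((\<lambda>S. G (of_real S * cis (pi / 4))) \<longlongrightarrow> G (of_real R * cis (pi / 4)) + ray_integral R (pi / 4) g) at_top"
  proof (rule ray_integral_primitive[OF assms(1) s(1) G cont])
    fix \<rho> assume "\<rho> \<ge> R"
    thus "norm (g (of_real \<rho> * cis (pi / 4))) \<le> 2 * B / (1 + \<rho>\<^sup>2)"
      unfolding scaled_cis_45 by (intro order.trans[OF B bd] divide_right_mono) auto
  qed auto
  have r2: "((\<lambda>S. G (of_real S * cis (3 * pi / 4))) \<longlongrightarrow>
      G (of_real R * cis (3 * pi / 4)) + ray_integral R (3 * pi / 4) g) at_top"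
  proof (rule ray_integral_primitive[OF assms(1) s(2) G cont])
    fix \<rho> assume "\<rho> \<ge> R"
    thus "norm (g (of_real \<rho> * cis (3 * pi / 4))) \<le> 2 * B / (1 + \<rho>\<^sup>2)"
      unfolding scaled_cis_135 by (intro order.trans[OF B bd] divide_right_mono) auto
  qed auto
  let ?p = "part_circlepath 0 R (3 * pi / 4) (pi / 4)"
  have "path_image ?p \<subseteq> {z. Im z > 0}"
    unfolding path_image_part_circlepath'
    using assms(1) pi_gt_zero
    by (auto simp: closed_segment_eq_real_ivl simp del: pi_gt_zero intro!: mult_pos_pos sin_gt_zero)
  hence "(g has_contour_integral (G (pathfinish ?p) - G (pathstart ?p))) ?p"
    by (intro contour_integral_primitive[where S = "{z. Im z > 0}"])
       (auto intro: has_field_derivative_at_within G)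
  hence arc: "contour_integral ?p g = G (of_real R * cis (pi / 4)) - G (of_real R * cis (3 * pi / 4))"
    by (simp add: contour_integral_unique cis_conv_exp mult.commute)
  have "((\<lambda>S. G (of_real S * cis (pi / 4)) - G (of_real S * cis (3 * pi / 4))) \<longlongrightarrow>
    bdOmega_integral R g) at_top"
    using tendsto_diff[OF r1 r2] unfolding bdOmega_integral_def arc by (simp add: algebra_simps)
  \<comment> \<open>Replacing S by sqrt 2 * S turns the modulus into the height.\<close>
  moreover have "filterlim (\<lambda>S. sqrt 2 * S) at_top at_top"
    by (rule filterlim_tendsto_pos_mult_at_top[OF tendsto_const _ filterlim_ident]) simp
  ultimately have "((\<lambda>S. G (of_real (sqrt 2 * S) * cis (pi / 4)) - G (of_real (sqrt 2 * S) * cis (3 * pi / 4))) \<longlongrightarrow>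
    bdOmega_integral R g) at_top"
    by (rule filterlim_compose)
  thus ?thesis unfolding scaled_cis_45 scaled_cis_135 by simp
qed

section \<open>Primitives and bounds for their increments\<close>

lemma primitive_upper_half_plane:
  assumes "g holomorphic_on {z. Im z > 0}"
  obtains G where "\<And>z. Im z > 0 \<Longrightarrow> (G has_field_derivative g z) (at z)"
proof -
  have "convex {z. Im z > 0}" "open {z. Im z > 0}"
    using convex_halfspace_Im_gt[of 0] open_halfspace_Im_gt[of 0] by simp_all
  with assms obtain G where
    "\<And>z. z \<in> {z. Im z > 0} \<Longrightarrow> (G has_field_derivative g z) (at z within {z. Im z > 0})"
    by (rule_tac holomorphic_convex_primitive') auto
  with \<open>open _\<close> show thesis
    by (intro that[of G]) (auto simp: at_within_open[of _ "{z. Im z > 0}"])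
qed

text \<open>Mean value inequality on the horizontal segment at height s, whose length is
  \<open>s * (b - a)\<close>.\<close>

lemma segment_bound:
  fixes G g :: "complex \<Rightarrow> complex"
  assumes G: "\<And>z. Im z > 0 \<Longrightarrow> (G has_field_derivative g z) (at z)"
    and "s > 0" "a \<le> b"
    and B: "\<And>x. x \<in> {a..b} \<Longrightarrow> norm (g (of_real s * Complex x 1)) \<le> B"
  shows "norm (G (of_real s * Complex b 1) - G (of_real s * Complex a 1)) \<le> B * (s * (b - a))"
proof (cases "a = b")
  case False
  have d: "((\<lambda>x. G (of_real s * Complex x 1)) has_vector_derivative
      of_real s * g (of_real s * Complex x 1)) (at x)" for x
  proof -
    have "Im (of_real s * Complex x 1) > 0" using assms(2) by simp
    hence "(G has_field_derivative g (of_real s * Complex x 1)) (at (of_real s * Complex x 1))"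
      by (rule G)
    moreover have "((\<lambda>x. of_real s * Complex x 1) has_vector_derivative of_real s) (at x)"
      unfolding Complex_eq by (auto intro!: derivative_eq_intros)
    ultimately show ?thesis
      using field_vector_diff_chain_at unfolding o_def by blast
  qed
  have "norm (G (of_real s * Complex b 1) - G (of_real s * Complex a 1)) \<le> B * s * b - B * s * a"
  proof (rule differentiable_bound_general)
    show "a < b" using False assms by simp
    show "continuous_on {a..b} (\<lambda>x. G (of_real s * Complex x 1))"
      using has_vector_derivative_continuous[OF d]
      by (intro continuous_at_imp_continuous_on) simp
    show "continuous_on {a..b} (\<lambda>x. B * s * x)" by (intro continuous_intros)
    fix x assume x: "a < x" "x < b"
    show "((\<lambda>x. G (of_real s * Complex x 1)) has_vector_derivative
      of_real s * g (of_real s * Complex x 1)) (at x)" by (rule d)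
    show "((\<lambda>x. B * s * x) has_vector_derivative B * s) (at x)"
      by (auto intro!: derivative_eq_intros)
    show "norm (of_real s * g (of_real s * Complex x 1)) \<le> B * s"
      using mult_left_mono[OF B[of x], of s] x assms(2) by (simp add: norm_mult mult.commute)
  qed
  thus ?thesis by (simp add: algebra_simps)
qed simp

text \<open>The majorant has the primitive \<open>arctan\<close>, whose increments never exceed pi.
  The bound is therefore uniform in \<open>S\<close> and survives the limit along the ray.\<close>

lemma ray_bound:
  fixes G g :: "complex \<Rightarrow> complex"
  assumes G: "\<And>z. Im z > 0 \<Longrightarrow> (G has_field_derivative g z) (at z)"
    and "s\<^sub>0 > 0" "s\<^sub>0 \<le> S" "B \<ge> 0"
    and B: "\<And>s. s \<ge> s\<^sub>0 \<Longrightarrow> norm (g (of_real s * Complex a 1)) \<le> B / (1 + s\<^sup>2)"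
  shows "norm (G (of_real S * Complex a 1) - G (of_real s\<^sub>0 * Complex a 1)) \<le> B * cmod (Complex a 1) * pi"
proof (cases "s\<^sub>0 = S")
  case False
  define c where "c = B * cmod (Complex a 1)"
  have c: "c \<ge> 0" using assms(4) by (simp add: c_def)
  have d: "((\<lambda>s. G (of_real s * Complex a 1)) has_vector_derivative
      Complex a 1 * g (of_real s * Complex a 1)) (at s)" if "s > 0" for s
  proof -
    have "Im (of_real s * Complex a 1) > 0" using that by simp
    hence "(G has_field_derivative g (of_real s * Complex a 1)) (at (of_real s * Complex a 1))"
      by (rule G)
    moreover have "((\<lambda>s. of_real s * Complex a 1) has_vector_derivative Complex a 1) (at s)"
      by (auto intro!: derivative_eq_intros)
    ultimately show ?thesis
      using field_vector_diff_chain_at unfolding o_def by blast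
  qed
  have "norm (G (of_real S * Complex a 1) - G (of_real s\<^sub>0 * Complex a 1)) \<le> c * arctan S - c * arctan s\<^sub>0"
  proof (rule differentiable_bound_general)
    show "s\<^sub>0 < S" using False assms by simp
    show "continuous_on {s\<^sub>0..S} (\<lambda>s. G (of_real s * Complex a 1))"
      using assms(2) has_vector_derivative_continuous[OF d]
      by (intro continuous_at_imp_continuous_on) simp
    show "continuous_on {s\<^sub>0..S} (\<lambda>s. c * arctan s)" by (intro continuous_intros)
    fix s assume s: "s\<^sub>0 < s" "s < S"
    show "((\<lambda>s. G (of_real s * Complex a 1)) has_vector_derivative
      Complex a 1 * g (of_real s * Complex a 1)) (at s)" using d s assms(2) by simp
    show "((\<lambda>s. c * arctan s) has_vector_derivative c / (1 + s\<^sup>2)) (at s)"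
      unfolding has_real_derivative_iff_has_vector_derivative[symmetric]
      by (auto intro!: derivative_eq_intros simp: field_simps)
    show "norm (Complex a 1 * g (of_real s * Complex a 1)) \<le> c / (1 + s\<^sup>2)"
      using mult_left_mono[OF B[of s], of "cmod (Complex a 1)"] s
      by (simp add: norm_mult c_def mult.commute)
  qed
  also have "\<dots> = c * (arctan S - arctan s\<^sub>0)" by (simp add: algebra_simps)
  also have "\<dots> \<le> c * pi"
    using arctan_ubound[of S] arctan_lbound[of s\<^sub>0] c by (intro mult_left_mono) linarith+
  finally show ?thesis by (simp add: c_def)
qed (use assms in simp)

section \<open>The boundary integral of the heat kernel\<close>

lemma norm_diff_chain:
  fixes a b c d :: "'a :: real_normed_vector"
  assumes "norm (a - b) \<le> A" "norm (b - c) \<le> B" "norm (d - c) \<le> D"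
  shows "norm (a - d) \<le> A + B + D"
  using assms norm_triangle_ineq[of "a - b" "b - c"] norm_triangle_ineq4[of "a - c" "d - c"] by simp

text \<open>A single term of the exponential series is at most its sum. This is where the
  \<open>fact n\<close> in the growth bound for the kernels originates.\<close>

lemma power_le_fact_mult_exp:
  fixes y :: real
  assumes "y \<ge> 0"
  shows "y ^ n \<le> fact n * exp y"
proof -
  have "(\<Sum>k\<in>{n}. y ^ k /\<^sub>R fact k) \<le> (\<Sum>k. y ^ k /\<^sub>R fact k)"
    using assms by (intro sum_le_suminf summable_exp_generic) auto
  hence "y ^ n / fact n \<le> exp y" by (simp add: exp_def divide_inverse mult.commute)
  thus ?thesis by (simp add: field_simps)
qed

text \<open>Multiplying by 1 + s^2 splits the left side into the powers p and p + 2, and each is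
  bounded through the previous inequality at y = L * s.\<close>

lemma power_exp_decay:
  fixes L :: real
  assumes "L > 0"
  obtains B where "B \<ge> 0" "\<And>s. s \<ge> 0 \<Longrightarrow> s ^ p * exp (- (L * s)) \<le> B / (1 + s\<^sup>2)"
proof -
  have *: "s ^ p * exp (- (L * s)) \<le> fact p / L ^ p" if "s \<ge> 0" for s p
  proof -
    have "(L * s) ^ p \<le> fact p * exp (L * s)"
      using that assms by (intro power_le_fact_mult_exp) auto
    thus ?thesis using assms by (simp add: field_simps exp_minus power_mult_distrib)
  qed
  show thesis
  proof (rule that)
    let ?B = "fact p / L ^ p + fact (p + 2) / L ^ (p + 2)"
    show "?B \<ge> 0" using assms by (intro add_nonneg_nonneg divide_nonneg_nonneg) auto
    fix s :: real assume s: "s \<ge> 0"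
    have "s ^ p * exp (- (L * s)) * (1 + s\<^sup>2) = s ^ p * exp (- (L * s)) + s ^ (p + 2) * exp (- (L * s))"
      by (simp add: algebra_simps power2_eq_square)
    also have "\<dots> \<le> ?B" using *[OF s] by (intro add_mono)
    finally show "s ^ p * exp (- (L * s)) \<le> ?B / (1 + s\<^sup>2)"
      by (subst pos_le_divide_eq) (auto intro: add_pos_nonneg)
  qed
qed

section \<open>The integrand: holomorphy and pointwise bounds\<close>

definition heat_kernel :: "real \<Rightarrow> nat \<Rightarrow> real \<Rightarrow> complex \<Rightarrow> complex" where
  "heat_kernel L n \<tau> k = k ^ (2 * n) * (exp (\<i> * k * of_real L) / (exp (2 * \<i> * k * of_real L) - 1)) *
     exp (- (k ^ 2) * of_real \<tau>)"

text \<open>The modulus of exp(ikL) depends on Im k only. All zeros of the denominator are real, so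
  above height \<open>h\<close> the denominator stays away from 0 and the quotient decays
  exponentially in the height, uniformly in Re k.\<close>

lemma exp_quotient_bound:
  assumes "L > 0" "h > 0" "Im k \<ge> h"
  shows "exp (2 * \<i> * k * of_real L) \<noteq> 1"
    and "norm (exp (\<i> * k * of_real L) / (exp (2 * \<i> * k * of_real L) - 1))
      \<le> exp (- (L * Im k)) / (1 - exp (- (2 * L * h)))"
proof -
  have "norm (exp (2 * \<i> * k * of_real L)) = exp (- (2 * L * Im k))"
    by (simp add: mult_ac)
  also have "\<dots> \<le> exp (- (2 * L * h))" using assms by simp
  finally have le: "norm (exp (2 * \<i> * k * of_real L)) \<le> exp (- (2 * L * h))" .
  have lt: "exp (- (2 * L * h)) < 1" using assms by simp
  show "exp (2 * \<i> * k * of_real L) \<noteq> 1" using le lt by (metis norm_one not_le)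
  have "1 - exp (- (2 * L * h)) \<le> norm (exp (2 * \<i> * k * of_real L) - 1)"
    using norm_triangle_ineq3[of "exp (2 * \<i> * k * of_real L)" 1] le unfolding norm_one by linarith
  moreover have "norm (exp (\<i> * k * of_real L)) = exp (- (L * Im k))"
    by (simp add: mult_ac)
  ultimately show "norm (exp (\<i> * k * of_real L) / (exp (2 * \<i> * k * of_real L) - 1))
      \<le> exp (- (L * Im k)) / (1 - exp (- (2 * L * h)))"
    using lt unfolding norm_divide by (intro frac_le) auto
qed

lemma holomorphic_heat_kernel:
  assumes "L > 0"
  shows "heat_kernel L n \<tau> holomorphic_on {z. Im z > 0}"
proof -
  have "exp (2 * \<i> * k * of_real L) - 1 \<noteq> 0" if "Im k > 0" for k
    using exp_quotient_bound(1)[OF assms that order.refl] by simp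
  thus ?thesis unfolding heat_kernel_def by (intro holomorphic_intros) auto
qed

lemma cmod_of_real_mult_Complex_power2: "(cmod (of_real s * Complex a 1))\<^sup>2 = (a\<^sup>2 + 1) * s\<^sup>2"
  by (simp add: norm_mult power_mult_distrib cmod_power2)

lemma Re_of_real_mult_Complex_power2: "Re ((of_real s * Complex a 1)\<^sup>2) = (a\<^sup>2 - 1) * s\<^sup>2"
  by (simp add: power_mult_distrib algebra_simps power2_eq_square)

text \<open>At k = s(a + i) the real part of k^2 is (a^2 - 1) s^2. For positive \<tau> the slope
  therefore decides how the heat factor behaves: growth for |a| < 1, modulus 1 for |a| = 1, Gaussian
  decay for |a| > 1.\<close>

lemma heat_kernel_bound:
  assumes "L > 0" "h > 0" "s \<ge> h"
  shows "norm (heat_kernel L n \<tau> (of_real s * Complex a 1)) \<le>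
    ((a\<^sup>2 + 1) * s\<^sup>2) ^ n * (exp (- (L * s)) / (1 - exp (- (2 * L * h)))) * exp (- (\<tau> * ((a\<^sup>2 - 1) * s\<^sup>2)))"
proof -
  let ?k = "of_real s * Complex a 1"
  have "Im ?k = s" by simp
  hence "norm (exp (\<i> * ?k * of_real L) / (exp (2 * \<i> * ?k * of_real L) - 1))
      \<le> exp (- (L * s)) / (1 - exp (- (2 * L * h)))"
    using exp_quotient_bound(2)[OF assms(1,2), of ?k] assms(3) by metis
  moreover have "norm (exp (- (?k ^ 2) * of_real \<tau>)) = exp (- (\<tau> * ((a\<^sup>2 - 1) * s\<^sup>2)))"
    unfolding norm_exp_eq_Re using Re_of_real_mult_Complex_power2[of s a] by (simp add: mult_ac)
  moreover have "norm (?k ^ (2 * n)) = ((a\<^sup>2 + 1) * s\<^sup>2) ^ n"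
    unfolding norm_power power_mult cmod_of_real_mult_Complex_power2 ..
  ultimately show ?thesis
    unfolding heat_kernel_def norm_mult[of _ "exp _"] norm_mult[of "_ ^ (2 * n)"]
    using assms by (intro mult_mono) (auto intro!: mult_nonneg_nonneg divide_nonneg_nonneg)
qed

text \<open>Two mean value inequalities in succession: the second derivative, bounded by |w|^2 D,
  controls the variation of the first, and this controls the error of the linearisation.\<close>

lemma exp_taylor_bound:
  fixes w :: complex
  assumes D: "\<And>\<sigma>. \<sigma> \<in> {0..T} \<Longrightarrow> norm (exp (- w * of_real \<sigma>)) \<le> D"
    and "x \<in> {0..T}" "y \<in> {0..T}"
  shows "norm (exp (- w * of_real y) - exp (- w * of_real x) + of_real (y - x) * (w * exp (- w * of_real x)))
    \<le> (norm w)\<^sup>2 * D * (y - x)\<^sup>2"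
proof -
  let ?S = "closed_segment x y"
  have sub: "?S \<subseteq> {0..T}" using assms(2,3) by (simp add: closed_segment_subset)
  have d0: "((\<lambda>\<sigma>. exp (- w * of_real \<sigma>)) has_vector_derivative - w * exp (- w * of_real \<sigma>)) (at \<sigma> within A)" for \<sigma> A
    by (rule has_vector_derivative_real_field) (auto intro!: derivative_eq_intros)
  have lin: "norm (- w * exp (- w * of_real \<sigma>) - (- w * exp (- w * of_real x))) \<le> (norm w)\<^sup>2 * D * \<bar>y - x\<bar>" if \<sigma>: "\<sigma> \<in> ?S" for \<sigma>
  proof -
    have "norm (- w * exp (- w * of_real \<sigma>) - (- w * exp (- w * of_real x))) \<le>
        (norm w)\<^sup>2 * D * norm (complex_of_real \<sigma> - of_real x)"
    proof (rule field_differentiable_bound[where f = "\<lambda>z. - w * exp (- w * z)"])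
      let ?C = "of_real ` ?S :: complex set"
      show "convex ?C" by (intro convex_linear_image convex_closed_segment) (simp add: linear_linear bounded_linear.linear bounded_linear_of_real)
      show "of_real \<sigma> \<in> ?C" "of_real x \<in> ?C" using \<sigma> by auto
      fix z assume "z \<in> ?C"
      then obtain \<rho> where \<rho>: "\<rho> \<in> {0..T}" "z = of_real \<rho>" using sub by auto
      show "((\<lambda>z. - w * exp (- w * z)) has_field_derivative w\<^sup>2 * exp (- w * z)) (at z within ?C)"
        by (auto intro!: derivative_eq_intros simp: power2_eq_square)
      show "norm (w\<^sup>2 * exp (- w * z)) \<le> (norm w)\<^sup>2 * D"
        unfolding norm_mult norm_power \<rho>(2) by (intro mult_left_mono D \<rho>) simp
    qed
    also have "norm (complex_of_real \<sigma> - of_real x) \<le> \<bar>y - x\<bar>"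
      using \<sigma> by (auto simp: closed_segment_eq_real_ivl simp flip: of_real_diff split: if_splits)
    finally show ?thesis
      using order.trans[OF norm_ge_zero D[OF assms(2)]] by (simp add: mult_left_mono)
  qed
  have "norm (exp (- w * of_real y) - exp (- w * of_real x) - (y - x) *\<^sub>R (- w * exp (- w * of_real x)))
    \<le> norm (y - x) * ((norm w)\<^sup>2 * D * \<bar>y - x\<bar>)"
    by (rule vector_differentiable_bound_linearization[where S = ?S, OF d0 order.refl lin]) auto
  thus ?thesis
    by (simp add: scaleR_conv_of_real mult_ac power2_eq_square flip: abs_mult)
qed

text \<open>Differentiation in \<tau> multiplies the integrand by -k^2, that is, raises
  \<open>n\<close> by one and changes the sign. The left side is thus a first-order Taylor
  remainder; it carries a further k^4, hence the exponent \<open>n + 2\<close>. Since |a| \<le> 1,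
  the factor with \<open>T\<close> dominates the heat factor at all times in [0, T].\<close>

lemma heat_kernel_taylor_bound:
  assumes "L > 0" "h > 0" "s \<ge> h" "\<bar>a\<bar> \<le> 1" "x \<in> {0..T}" "y \<in> {0..T}"
  shows "norm (heat_kernel L n y (of_real s * Complex a 1) - heat_kernel L n x (of_real s * Complex a 1) +
      of_real (y - x) * heat_kernel L (Suc n) x (of_real s * Complex a 1)) \<le>
    (2 * s\<^sup>2) ^ (n + 2) * (exp (- (L * s)) / (1 - exp (- (2 * L * h)))) * exp (T * ((1 - a\<^sup>2) * s\<^sup>2)) * (y - x)\<^sup>2"
proof -
  define k where "k = of_real s * Complex a 1"
  define E where "E = exp (\<i> * k * of_real L) / (exp (2 * \<i> * k * of_real L) - 1)"
  have a2: "a\<^sup>2 \<le> 1" using assms(4) by (simp add: abs_square_le_1)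
  have E: "norm E \<le> exp (- (L * s)) / (1 - exp (- (2 * L * h)))"
    using exp_quotient_bound(2)[OF assms(1,2), of k] assms(3) by (simp add: E_def k_def)
  have k2: "(norm k)\<^sup>2 \<le> 2 * s\<^sup>2"
    unfolding k_def cmod_of_real_mult_Complex_power2 using a2 by (intro mult_right_mono) auto
  have nn: "exp (- (L * s)) / (1 - exp (- (2 * L * h))) \<ge> 0" using assms by simp
  have D: "norm (exp (- k\<^sup>2 * of_real \<sigma>)) \<le> exp (T * ((1 - a\<^sup>2) * s\<^sup>2))" if "\<sigma> \<in> {0..T}" for \<sigma>
  proof -
    have "norm (exp (- k\<^sup>2 * of_real \<sigma>)) = exp (\<sigma> * ((1 - a\<^sup>2) * s\<^sup>2))"
    proof -
      have "Re (- k\<^sup>2 * of_real \<sigma>) = - (\<sigma> * Re (k\<^sup>2))" by simp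
      thus ?thesis
        unfolding norm_exp_eq_Re k_def Re_of_real_mult_Complex_power2 by (simp add: algebra_simps)
    qed
    also have "\<dots> \<le> exp (T * ((1 - a\<^sup>2) * s\<^sup>2))" using that a2 by (simp add: mult_right_mono)
    finally show ?thesis .
  qed
  have "heat_kernel L n y k - heat_kernel L n x k + of_real (y - x) * heat_kernel L (Suc n) x k =
    k ^ (2 * n) * E * (exp (- k\<^sup>2 * of_real y) - exp (- k\<^sup>2 * of_real x) + of_real (y - x) * (k\<^sup>2 * exp (- k\<^sup>2 * of_real x)))"
    unfolding heat_kernel_def E_def[symmetric] by (simp add: algebra_simps power2_eq_square)
  also have "norm \<dots> \<le> (2 * s\<^sup>2) ^ n * (exp (- (L * s)) / (1 - exp (- (2 * L * h)))) *
      ((2 * s\<^sup>2)\<^sup>2 * exp (T * ((1 - a\<^sup>2) * s\<^sup>2)) * (y - x)\<^sup>2)"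
    unfolding norm_mult[of "_ * E"] norm_mult[of _ E] norm_power power_mult
  proof (intro mult_mono power_mono E k2)
    have "norm (exp (- k\<^sup>2 * of_real y) - exp (- k\<^sup>2 * of_real x) + of_real (y - x) * (k\<^sup>2 * exp (- k\<^sup>2 * of_real x)))
      \<le> (norm (k\<^sup>2))\<^sup>2 * exp (T * ((1 - a\<^sup>2) * s\<^sup>2)) * (y - x)\<^sup>2"
      using D assms by (intro exp_taylor_bound)
    also have "\<dots> \<le> (2 * s\<^sup>2)\<^sup>2 * exp (T * ((1 - a\<^sup>2) * s\<^sup>2)) * (y - x)\<^sup>2"
      unfolding norm_power using k2 by (intro mult_right_mono power_mono) auto
    finally show "norm (exp (- k\<^sup>2 * of_real y) - exp (- k\<^sup>2 * of_real x) + of_real (y - x) * (k\<^sup>2 * exp (- k\<^sup>2 * of_real x)))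
      \<le> (2 * s\<^sup>2)\<^sup>2 * exp (T * ((1 - a\<^sup>2) * s\<^sup>2)) * (y - x)\<^sup>2" .
  qed (use nn in \<open>auto intro!: mult_nonneg_nonneg simp del: times_divide_eq_right\<close>)
  finally show ?thesis unfolding k_def by (simp add: power_add mult_ac)
qed

section \<open>The boundary integral as a function of time: value at 0, growth in n,
  derivative\<close>

definition bdOmega_kernel :: "real \<Rightarrow> real \<Rightarrow> nat \<Rightarrow> real \<Rightarrow> complex" where
  "bdOmega_kernel L R n \<tau> = bdOmega_integral R (heat_kernel L n \<tau>)"

text \<open>On the rays of slope 1 and -1 the heat factor has modulus 1, so the decay of the
  quotient of exponentials supplies the majorant. This works for every \<tau>, including \<tau> =
  0.\<close>

lemma bdOmega_kernel_primitive:
  assumes "L > 0" "R > 0"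
    and G: "\<And>z. Im z > 0 \<Longrightarrow> (G has_field_derivative heat_kernel L n \<tau> z) (at z)"
  shows "((\<lambda>S. G (of_real S * Complex 1 1) - G (of_real S * Complex (- 1) 1)) \<longlongrightarrow>
    bdOmega_kernel L R n \<tau>) at_top"
proof -
  obtain B where B: "B \<ge> 0" "\<And>s. s \<ge> 0 \<Longrightarrow> s ^ (2 * n) * exp (- (L * s)) \<le> B / (1 + s\<^sup>2)"
    using power_exp_decay[OF assms(1)] by blast
  define h where "h = R / sqrt 2"
  have h: "h > 0" using assms by (simp add: h_def)
  define c where "c = 2 ^ n / (1 - exp (- (2 * L * h)))"
  have c: "c \<ge> 0" using assms h by (simp add: c_def)
  show ?thesis
    unfolding bdOmega_kernel_def
  proof (rule bdOmega_integral_primitive[OF assms(2) G])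
    show "continuous_on {z. Im z > 0} (heat_kernel L n \<tau>)"
      using holomorphic_heat_kernel[OF assms(1)] by (rule holomorphic_on_imp_continuous_on)
    fix s a :: real assume s: "s \<ge> R / sqrt 2" and a: "\<bar>a\<bar> = 1"
    have a2: "a\<^sup>2 = 1" using a by (metis power2_abs one_power2)
    have "norm (heat_kernel L n \<tau> (of_real s * Complex a 1)) \<le> 
      (2 * s\<^sup>2) ^ n * (exp (- (L * s)) / (1 - exp (- (2 * L * h))))"
      using heat_kernel_bound[OF assms(1) h, of s n \<tau> a] s a2 by (simp add: h_def)
    also have "\<dots> = c * (s ^ (2 * n) * exp (- (L * s)))"
      by (simp add: c_def power_mult_distrib power_mult)
    also have "\<dots> \<le> c * (B / (1 + s\<^sup>2))"
      using s h by (intro mult_left_mono B c) (simp add: h_def)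
    finally show "norm (heat_kernel L n \<tau> (of_real s * Complex a 1)) \<le> (c * B) / (1 + s\<^sup>2)" by simp
  qed
qed

text \<open>
  The condition on \<open>\<tau>\<close> says that \<open>exp (-k\<^sup>2\<tau>)\<close> is bounded by 1 on the segments, so that the quotient
  of exponentials alone provides the decay.
\<close>
lemma heat_kernel_segment_tendsto_0:
  assumes "L > 0" "a \<le> b"
    and x: "\<And>x. x \<in> {a..b} \<Longrightarrow> \<bar>x\<bar> \<le> 2 \<and> \<tau> * (x\<^sup>2 - 1) \<ge> 0"
    and G: "\<And>z. Im z > 0 \<Longrightarrow> (G has_field_derivative heat_kernel L n \<tau> z) (at z)"
  shows "((\<lambda>S. G (of_real S * Complex b 1) - G (of_real S * Complex a 1)) \<longlongrightarrow> 0) at_top"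
proof -
  \<comment> \<open>The extra power of s in \<open>2 * n + 1\<close> absorbs the length of the
    segment, which is proportional to its height.\<close>
  obtain B where B: "B \<ge> 0" "\<And>s. s \<ge> 0 \<Longrightarrow> s ^ (2 * n + 1) * exp (- (L * s)) \<le> B / (1 + s\<^sup>2)"
    using power_exp_decay[OF assms(1)] by blast
  \<comment> \<open>Here 5 bounds x^2 + 1 for |x| \<le> 2, and the denominator is the one for height
    at least 1, which suffices for large \<open>S\<close>.\<close>
  define c where "c = 5 ^ n / (1 - exp (- (2 * L))) * (b - a)"
  have c: "c \<ge> 0" using assms by (simp add: c_def)
  show ?thesis
  proof (rule Lim_null_comparison)
    show "((\<lambda>S::real. c * (B / (1 + S\<^sup>2))) \<longlongrightarrow> 0) at_top" by real_asymp
    show "eventually (\<lambda>S. norm (G (of_real S * Complex b 1) - G (of_real S * Complex a 1))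
      \<le> c * (B / (1 + S\<^sup>2))) at_top"
      using eventually_ge_at_top[of 1]
    proof eventually_elim
      case (elim S)
      have "norm (G (of_real S * Complex b 1) - G (of_real S * Complex a 1)) \<le>
        ((5 * S\<^sup>2) ^ n * (exp (- (L * S)) / (1 - exp (- (2 * L * 1))))) * (S * (b - a))"
      proof (rule segment_bound[OF G _ assms(2)])
        fix y assume y: "y \<in> {a..b}"
        have y2: "y\<^sup>2 + 1 \<le> 5" using abs_le_square_iff[of y 2] x[OF y] by simp
        have "norm (heat_kernel L n \<tau> (of_real S * Complex y 1)) \<le> 
          ((y\<^sup>2 + 1) * S\<^sup>2) ^ n * (exp (- (L * S)) / (1 - exp (- (2 * L * 1)))) * exp (- (\<tau> * ((y\<^sup>2 - 1) * S\<^sup>2)))"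
          using elim by (intro heat_kernel_bound assms) auto
        also have "\<dots> \<le> (5 * S\<^sup>2) ^ n * (exp (- (L * S)) / (1 - exp (- (2 * L * 1)))) * 1"
        proof (intro mult_mono power_mono)
          have "0 \<le> \<tau> * (y\<^sup>2 - 1) * S\<^sup>2" using x[OF y] by simp
          thus "exp (- (\<tau> * ((y\<^sup>2 - 1) * S\<^sup>2))) \<le> 1" by (simp add: mult.assoc)
        qed (use y2 assms(1) elim in \<open>auto intro!: mult_nonneg_nonneg add_nonneg_nonneg\<close>)
        finally show "norm (heat_kernel L n \<tau> (of_real S * Complex y 1)) \<le>
          (5 * S\<^sup>2) ^ n * (exp (- (L * S)) / (1 - exp (- (2 * L * 1))))" by simp
      qed (use elim in auto)
      also have "\<dots> = c * (S ^ (2 * n + 1) * exp (- (L * S)))"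
        by (simp add: c_def power_mult_distrib power_mult)
      also have "\<dots> \<le> c * (B / (1 + S\<^sup>2))"
        using elim by (intro mult_left_mono B c) simp
      finally show ?case .
    qed
  qed
qed

text \<open>At \<tau> = 0 the heat factor is 1 for every slope, so the increment of the primitive
  across the whole segment from slope -1 to slope 1 tends to 0; by the previous representation it
  also tends to the kernel.\<close>

lemma bdOmega_kernel_0:
  assumes "L > 0" "R > 0"
  shows "bdOmega_kernel L R n 0 = 0"
proof -
  obtain G where G: "\<And>z. Im z > 0 \<Longrightarrow> (G has_field_derivative heat_kernel L n 0 z) (at z)"
    using primitive_upper_half_plane[OF holomorphic_heat_kernel[OF assms(1)]] by blast
  have "((\<lambda>S. G (of_real S * Complex 1 1) - G (of_real S * Complex (- 1) 1)) \<longlongrightarrow> 0) at_top"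
    by (rule heat_kernel_segment_tendsto_0[OF assms(1) _ _ G]) auto
  thus ?thesis using bdOmega_kernel_primitive[OF assms G] tendsto_unique by force
qed

text \<open>The ends at infinity move from slopes 1 and -1 to 2 and -2, where the heat factor is
  exp(-3 t s^2), and the contour is replaced by two such rays joined by a horizontal segment at
  height \<open>R\<close>. The constants depend on \<open>t\<close> but not on
  \<open>n\<close>.\<close>

lemma bdOmega_kernel_bound:
  assumes "L > 0" "R > 0" "t > 0"
  obtains C M where "C \<ge> 0" "M \<ge> 1" "\<And>n. norm (bdOmega_kernel L R n t) \<le> C * fact n * M ^ n"
proof -
  define c where "c = 1 / (1 - exp (- (2 * L * R)))"
  have c: "c \<ge> 0" using assms by (simp add: c_def)
  \<comment> \<open>Chosen so that 1 + s^2 \<le> e (1 + 2 t s^2).\<close>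
  define e where "e = 1 + 1 / (2 * t)"
  have e: "e \<ge> 0" using assms by (simp add: e_def)
  \<comment> \<open>The rays require 5 / t, the segment 5 R^2, and the summand 1 ensures M \<ge>
    1.\<close>
  define M where "M = 1 + 5 / t + 5 * R\<^sup>2"
  have M: "M \<ge> 1" "5 / t \<le> M" "5 * R\<^sup>2 \<le> M" using assms by (auto simp: M_def)
  \<comment> \<open>Two rays, with sqrt 5 the modulus of 2 + i, and one segment of length 4
    R.\<close>
  define C where "C = 2 * (c * e * sqrt 5 * pi) + c * exp (t * R\<^sup>2) * (R * 4)"
  have le1: "exp (- (L * s)) / (1 - exp (- (2 * L * R))) \<le> c" if "s \<ge> R" for s
    unfolding c_def using assms that by (intro divide_right_mono) auto
  have ray: "norm (heat_kernel L n t (of_real s * Complex a 1)) \<le> (c * e * fact n * M ^ n) / (1 + s\<^sup>2)"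
    if s: "s \<ge> R" and a: "\<bar>a\<bar> = 2" for s n a
  proof -
    have a2: "a\<^sup>2 = 4" using a power2_abs[of a] by simp
    define y where "y = t * s\<^sup>2"
    have y: "y \<ge> 0" using assms by (simp add: y_def)
    have "norm (heat_kernel L n t (of_real s * Complex a 1)) \<le>
      (5 * s\<^sup>2) ^ n * (exp (- (L * s)) / (1 - exp (- (2 * L * R)))) * exp (- (3 * y))"
      using heat_kernel_bound[OF assms(1,2) s, of n t a] a2 by (simp add: y_def mult_ac)
    also have "\<dots> \<le> (5 * s\<^sup>2) ^ n * c * exp (- (3 * y))"
      by (intro mult_right_mono mult_left_mono le1 s) auto
    also have "(5 * s\<^sup>2) ^ n = (5 / t) ^ n * y ^ n"
    proof -
      have "5 * s\<^sup>2 = 5 / t * y" using assms(3) by (simp add: y_def)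
      thus ?thesis by (simp only: power_mult_distrib)
    qed
    \<comment> \<open>Of the decay exp(-3y), one factor exp(-y) is spent on y^n at the price of n!;
      the remaining exp(-2y) makes the bound integrable along the ray.\<close>
    also have "\<dots> * c * exp (- (3 * y)) \<le> (5 / t) ^ n * (fact n * exp y) * c * exp (- (3 * y))"
      using assms(3) c by (intro mult_right_mono mult_left_mono power_le_fact_mult_exp y) auto
    also have "\<dots> = c * fact n * (5 / t) ^ n * exp (- (2 * y))"
    proof -
      have "exp (- (2 * y)) = exp y * exp (- (3 * y))" by (simp flip: exp_add)
      thus ?thesis by (simp only:) (simp only: mult_ac)
    qed
    also have "\<dots> \<le> c * fact n * M ^ n * (e / (1 + s\<^sup>2))"
    proof (intro mult_mono power_mono M)
      have "1 + s\<^sup>2 \<le> e * (1 + 2 * y)" using assms(3) by (simp add: e_def y_def field_simps)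
      also have "\<dots> \<le> e * exp (2 * y)" by (intro mult_left_mono e exp_ge_add_one_self)
      finally have "exp (- (2 * y)) * (1 + s\<^sup>2) \<le> exp (- (2 * y)) * (e * exp (2 * y))"
        by (rule mult_left_mono) simp
      also have "\<dots> = e" by (simp add: exp_minus)
      finally show "exp (- (2 * y)) \<le> e / (1 + s\<^sup>2)"
        by (subst pos_le_divide_eq) (auto intro: add_pos_nonneg)
    qed (use assms c M in auto)
    finally show ?thesis by (simp add: mult_ac)
  qed
  have seg: "norm (heat_kernel L n t (of_real R * Complex a 1)) \<le> c * exp (t * R\<^sup>2) * fact n * M ^ n"
    if a: "a \<in> {-2..2}" for n a
  proof -
    have a2: "a\<^sup>2 + 1 \<le> 5" using abs_le_square_iff[of a 2] a by auto
    have "norm (heat_kernel L n t (of_real R * Complex a 1)) \<le>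
      ((a\<^sup>2 + 1) * R\<^sup>2) ^ n * (exp (- (L * R)) / (1 - exp (- (2 * L * R)))) * exp (- (t * ((a\<^sup>2 - 1) * R\<^sup>2)))"
      by (rule heat_kernel_bound) (use assms in auto)
    also have "\<dots> \<le> (fact n * M ^ n) * c * exp (t * R\<^sup>2)"
    proof (intro mult_mono le1)
      have "((a\<^sup>2 + 1) * R\<^sup>2) ^ n \<le> M ^ n"
        using a2 by (intro power_mono order.trans[OF mult_right_mono M(3)]) auto
      also have "\<dots> \<le> fact n * M ^ n"
        using M(1) mult_right_mono[OF fact_ge_1[of n], of "M ^ n"] by simp
      finally show "((a\<^sup>2 + 1) * R\<^sup>2) ^ n \<le> fact n * M ^ n" .
      have "t * ((1 - a\<^sup>2) * R\<^sup>2) \<le> t * (1 * R\<^sup>2)"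
        using assms by (intro mult_left_mono mult_right_mono) auto
      thus "exp (- (t * ((a\<^sup>2 - 1) * R\<^sup>2))) \<le> exp (t * R\<^sup>2)" by (simp add: algebra_simps)
    qed (use assms c M in auto)
    finally show ?thesis by (simp add: mult_ac)
  qed
  show thesis
  proof (rule that)
    show "C \<ge> 0" using c e assms by (simp add: C_def)
    show "M \<ge> 1" by (rule M)
    fix n
    obtain G where G: "\<And>z. Im z > 0 \<Longrightarrow> (G has_field_derivative heat_kernel L n t z) (at z)"
      using primitive_upper_half_plane[OF holomorphic_heat_kernel[OF assms(1)]] by blast
    define H where "H = (\<lambda>a S. G (of_real S * Complex a 1))"
    have r: "((\<lambda>S. H 2 S - H 1 S) \<longlongrightarrow> 0) at_top"
      unfolding H_def by (rule heat_kernel_segment_tendsto_0[OF assms(1) _ _ G]) (use assms in auto)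
    have l: "((\<lambda>S. H (- 1) S - H (- 2) S) \<longlongrightarrow> 0) at_top"
      unfolding H_def
    proof (rule heat_kernel_segment_tendsto_0[OF assms(1) _ _ G])
      fix x :: real assume "x \<in> {- 2..- 1}"
      thus "\<bar>x\<bar> \<le> 2 \<and> 0 \<le> t * (x\<^sup>2 - 1)" using assms abs_le_square_iff[of 1 x] by auto
    qed auto
    \<comment> \<open>The segment from slope -2 to slope 2 is cut at -1 and 1: the outer parts tend
      to 0 and the middle one to the kernel.\<close>
    have "((\<lambda>S. (H 2 S - H 1 S) + (H 1 S - H (- 1) S) + (H (- 1) S - H (- 2) S)) \<longlongrightarrow>
        0 + bdOmega_kernel L R n t + 0) at_top"
      by (intro tendsto_add r l, unfold H_def) (rule bdOmega_kernel_primitive[OF assms(1,2) G])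
    hence lim: "((\<lambda>S. H 2 S - H (- 2) S) \<longlongrightarrow> bdOmega_kernel L R n t) at_top" by simp
    show "norm (bdOmega_kernel L R n t) \<le> C * fact n * M ^ n"
    proof (rule Lim_norm_ubound[OF _ lim])
      show "eventually (\<lambda>S. norm (H 2 S - H (- 2) S) \<le> C * fact n * M ^ n) at_top"
        using eventually_ge_at_top[of R]
      proof eventually_elim
        case (elim S)
        have *: "norm (H a S - H a R) \<le> (c * e * fact n * M ^ n) * sqrt 5 * pi" if a: "\<bar>a\<bar> = 2" for a
        proof -
          have "a\<^sup>2 = 2\<^sup>2" using a by (metis power2_abs)
          hence "cmod (Complex a 1) = sqrt 5" by (simp add: cmod_def)
          thus ?thesis using ray_bound[OF G assms(2) elim(1) _ ray, of a] a c e M(1) unfolding H_def by simp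
        qed
        have "norm (H 2 R - H (- 2) R) \<le> (c * exp (t * R\<^sup>2) * fact n * M ^ n) * (R * (2 - (- 2)))"
          unfolding H_def using assms(2) by (intro segment_bound[OF G] seg) auto
        from norm_diff_chain[OF * this *]
        have "norm (H 2 S - H (- 2) S) \<le> (c * e * fact n * M ^ n) * sqrt 5 * pi +
          (c * exp (t * R\<^sup>2) * fact n * M ^ n) * (R * 4) + (c * e * fact n * M ^ n) * sqrt 5 * pi"
          by simp
        also have "\<dots> = C * fact n * M ^ n" by (simp add: C_def algebra_simps)
        finally show ?case .
      qed
    qed simp
  qed
qed

text \<open>The remainder of the integrand is integrated over rays of slope 1 and -1 joined at
  height \<open>R\<close>. There the heat factor is harmless uniformly in time, so \<open>C\<close>
  is independent of x and y, the endpoint 0 included. A quadratic remainder takes the place of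
  differentiation under the integral sign.\<close>

lemma bdOmega_kernel_taylor_bound:
  assumes "L > 0" "R > 0"
  obtains C where "\<And>x y. x \<in> {0..T} \<Longrightarrow> y \<in> {0..T} \<Longrightarrow>
    norm (bdOmega_kernel L R n y - bdOmega_kernel L R n x + of_real (y - x) * bdOmega_kernel L R (Suc n) x) \<le> C * (y - x)\<^sup>2"
proof -
  obtain B where B: "B \<ge> 0" "\<And>s. s \<ge> 0 \<Longrightarrow> s ^ (2 * (n + 2)) * exp (- (L * s)) \<le> B / (1 + s\<^sup>2)"
    using power_exp_decay[OF assms(1)] by blast
  define c where "c = 1 / (1 - exp (- (2 * L * R)))"
  have c: "c \<ge> 0" using assms by (simp add: c_def)
  \<comment> \<open>On the joining segment slopes below 1 in modulus occur, where the heat factor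
    may grow, but by at most exp(T R^2).\<close>
  define b where "b = (2 * R\<^sup>2) ^ (n + 2) * c * exp (T * R\<^sup>2)"
  define C where "C = 2 * (2 ^ (n + 2) * c * B * sqrt 2 * pi) + b * (R * 2)"
  show thesis
  proof (rule that)
    fix x y assume x: "x \<in> {0..T}" and y: "y \<in> {0..T}"
    define h where "h = (\<lambda>k. heat_kernel L n y k - heat_kernel L n x k + of_real (y - x) * heat_kernel L (Suc n) x k)"
    obtain G1 where G1: "\<And>z. Im z > 0 \<Longrightarrow> (G1 has_field_derivative heat_kernel L n y z) (at z)"
      using primitive_upper_half_plane[OF holomorphic_heat_kernel[OF assms(1)]] by blast
    obtain G2 where G2: "\<And>z. Im z > 0 \<Longrightarrow> (G2 has_field_derivative heat_kernel L n x z) (at z)"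
      using primitive_upper_half_plane[OF holomorphic_heat_kernel[OF assms(1)]] by blast
    obtain G3 where G3: "\<And>z. Im z > 0 \<Longrightarrow> (G3 has_field_derivative heat_kernel L (Suc n) x z) (at z)"
      using primitive_upper_half_plane[OF holomorphic_heat_kernel[OF assms(1)]] by blast
    \<comment> \<open>The same linear combination of primitives is a primitive of the remainder, so
      the limit representation passes to the combination of kernels.\<close>
    define G where "G = (\<lambda>z. G1 z - G2 z + of_real (y - x) * G3 z)"
    have G: "(G has_field_derivative h z) (at z)" if "Im z > 0" for z
      unfolding G_def h_def by (intro DERIV_add DERIV_diff DERIV_cmult G1 G2 G3 that)
    define H where "H = (\<lambda>a S. G (of_real S * Complex a 1))"
    let ?K = "bdOmega_kernel L R"
    have "((\<lambda>S. (G1 (of_real S * Complex 1 1) - G1 (of_real S * Complex (- 1) 1)) -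
        (G2 (of_real S * Complex 1 1) - G2 (of_real S * Complex (- 1) 1)) +
        of_real (y - x) * (G3 (of_real S * Complex 1 1) - G3 (of_real S * Complex (- 1) 1))) \<longlongrightarrow>
        ?K n y - ?K n x + of_real (y - x) * ?K (Suc n) x) at_top"
      by (intro tendsto_add tendsto_diff tendsto_mult_left bdOmega_kernel_primitive assms G1 G2 G3)
    also have "(\<lambda>S. (G1 (of_real S * Complex 1 1) - G1 (of_real S * Complex (- 1) 1)) -
        (G2 (of_real S * Complex 1 1) - G2 (of_real S * Complex (- 1) 1)) +
        of_real (y - x) * (G3 (of_real S * Complex 1 1) - G3 (of_real S * Complex (- 1) 1))) =
        (\<lambda>S. H 1 S - H (- 1) S)"
      unfolding H_def G_def by (simp only: algebra_simps)
    finally have lim: "((\<lambda>S. H 1 S - H (- 1) S) \<longlongrightarrow> ?K n y - ?K n x + of_real (y - x) * ?K (Suc n) x) at_top" .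
    have ray: "norm (h (of_real s * Complex a 1)) \<le> (2 ^ (n + 2) * c * B * (y - x)\<^sup>2) / (1 + s\<^sup>2)"
      if s: "s \<ge> R" and a: "\<bar>a\<bar> = 1" for s a
    proof -
      have a2: "a\<^sup>2 = 1" using a by (metis power2_abs one_power2)
      have "norm (h (of_real s * Complex a 1)) \<le>
        (2 * s\<^sup>2) ^ (n + 2) * (exp (- (L * s)) / (1 - exp (- (2 * L * R)))) * exp (T * ((1 - a\<^sup>2) * s\<^sup>2)) * (y - x)\<^sup>2"
        unfolding h_def using assms s a x y by (intro heat_kernel_taylor_bound) auto
      also have "\<dots> = 2 ^ (n + 2) * c * (s ^ (2 * (n + 2)) * exp (- (L * s))) * (y - x)\<^sup>2"
        unfolding power_mult power_mult_distrib by (simp add: a2 c_def)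
      also have "\<dots> \<le> 2 ^ (n + 2) * c * (B / (1 + s\<^sup>2)) * (y - x)\<^sup>2"
        using s assms c by (intro mult_left_mono mult_right_mono B) auto
      finally show ?thesis by simp
    qed
    have seg: "norm (h (of_real R * Complex a 1)) \<le> b * (y - x)\<^sup>2" if a: "a \<in> {- 1..1}" for a
    proof -
      have "norm (h (of_real R * Complex a 1)) \<le>
        (2 * R\<^sup>2) ^ (n + 2) * (exp (- (L * R)) / (1 - exp (- (2 * L * R)))) * exp (T * ((1 - a\<^sup>2) * R\<^sup>2)) * (y - x)\<^sup>2"
        unfolding h_def using assms a x y by (intro heat_kernel_taylor_bound) auto
      also have "\<dots> \<le> (2 * R\<^sup>2) ^ (n + 2) * c * exp (T * R\<^sup>2) * (y - x)\<^sup>2"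
      proof (intro mult_mono)
        show "exp (- (L * R)) / (1 - exp (- (2 * L * R))) \<le> c"
          unfolding c_def using assms by (intro divide_right_mono) auto
        have "T * ((1 - a\<^sup>2) * R\<^sup>2) \<le> T * (1 * R\<^sup>2)"
          using x by (intro mult_left_mono mult_right_mono) auto
        thus "exp (T * ((1 - a\<^sup>2) * R\<^sup>2)) \<le> exp (T * R\<^sup>2)" by simp
      qed (use assms c in auto)
      finally show ?thesis by (simp add: b_def)
    qed
    show "norm (?K n y - ?K n x + of_real (y - x) * ?K (Suc n) x) \<le> C * (y - x)\<^sup>2"
    proof (rule Lim_norm_ubound[OF _ lim])
      show "eventually (\<lambda>S. norm (H 1 S - H (- 1) S) \<le> C * (y - x)\<^sup>2) at_top"
        using eventually_ge_at_top[of R]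
      proof eventually_elim
        case (elim S)
        have *: "norm (H a S - H a R) \<le> (2 ^ (n + 2) * c * B * (y - x)\<^sup>2) * sqrt 2 * pi" if a: "\<bar>a\<bar> = 1" for a
        proof -
          have "a\<^sup>2 = 1\<^sup>2" using a by (metis power2_abs)
          hence "cmod (Complex a 1) = sqrt 2" by (simp add: cmod_def)
          thus ?thesis using ray_bound[OF G assms(2) elim(1) _ ray, of a] a c B(1) unfolding H_def by simp
        qed
        have "norm (H 1 R - H (- 1) R) \<le> (b * (y - x)\<^sup>2) * (R * (1 - (- 1)))"
          unfolding H_def using assms(2) by (intro segment_bound[OF G] seg) auto
        from norm_diff_chain[OF * this *]
        have "norm (H 1 S - H (- 1) S) \<le> (2 ^ (n + 2) * c * B * (y - x)\<^sup>2) * sqrt 2 * pi +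
          (b * (y - x)\<^sup>2) * (R * 2) + (2 ^ (n + 2) * c * B * (y - x)\<^sup>2) * sqrt 2 * pi"
          by simp
        also have "\<dots> = C * (y - x)\<^sup>2" by (simp add: C_def algebra_simps)
        finally show ?case .
      qed
    qed simp
  qed
qed

lemma bdOmega_kernel_has_vector_derivative:
  assumes "L > 0" "R > 0" "x \<in> {0..T}"
  shows "(bdOmega_kernel L R n has_vector_derivative - bdOmega_kernel L R (Suc n) x) (at x within {0..T})"
proof -
  obtain C where C: "\<And>x y. x \<in> {0..T} \<Longrightarrow> y \<in> {0..T} \<Longrightarrow>
    norm (bdOmega_kernel L R n y - bdOmega_kernel L R n x + of_real (y - x) * bdOmega_kernel L R (Suc n) x) \<le> C * (y - x)\<^sup>2"
    using bdOmega_kernel_taylor_bound[OF assms(1,2)] by blast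
  show ?thesis
    unfolding has_vector_derivative_def
  proof (rule has_derivativeI_sandwich[where e = 1])
    show "bounded_linear (\<lambda>h. h *\<^sub>R - bdOmega_kernel L R (Suc n) x)"
      by (rule bounded_linear_scaleR_left)
    show "((\<lambda>y. C * \<bar>y - x\<bar>) \<longlongrightarrow> 0) (at x within {0..T})"
      by (auto intro!: tendsto_eq_intros)
    fix y assume y: "y \<in> {0..T}" "y \<noteq> x"
    have "norm (bdOmega_kernel L R n y - bdOmega_kernel L R n x - (y - x) *\<^sub>R - bdOmega_kernel L R (Suc n) x)
      \<le> C * (y - x)\<^sup>2"
      using C[OF assms(3) y(1)] by (simp add: scaleR_conv_of_real)
    also have "\<dots> = (C * \<bar>y - x\<bar>) * norm (y - x)" by (simp add: power2_eq_square flip: abs_mult)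
    finally show "norm (bdOmega_kernel L R n y - bdOmega_kernel L R n x - (y - x) *\<^sub>R - bdOmega_kernel L R (Suc n) x)
      / norm (y - x) \<le> C * \<bar>y - x\<bar>"
      using y by (subst pos_divide_le_eq) auto
  qed simp
qed

section \<open>Repeated integration by parts\<close>

lemma cball_subset_tube:
  assumes "s \<in> {0..T}"
  shows "cball (of_real s) r \<subseteq> tube T r"
proof
  fix z :: complex assume "z \<in> cball (of_real s) r"
  hence "dist z (of_real s) \<le> r" by (simp add: dist_commute)
  moreover have "infdist z (of_real ` {0..T}) \<le> dist z (of_real s)" using assms by (intro infdist_le) auto
  ultimately show "z \<in> tube T r" unfolding tube_def by simp
qed

lemma compact_tube:
  assumes "T \<ge> 0" "r > 0"
  shows "compact (tube T r)"
  unfolding tube_def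
  using assms by (intro compact_infdist_le compact_continuous_image continuous_intros) auto

text \<open>The tube is compact and contains every closed disc of radius \<open>r\<close> about a
  point of [0, T], so a single supremum of |f| serves in Cauchy's inequality at all these
  points.\<close>

lemma higher_deriv_tube_bound:
  assumes "T \<ge> 0" "r > 0" "f analytic_on tube T r"
  obtains C M where "C \<ge> 0" "M \<ge> 1"
    "\<And>j s. s \<in> {0..T} \<Longrightarrow> norm ((deriv ^^ j) f (of_real s)) \<le> C * fact j * M ^ j"
proof -
  have "continuous_on (tube T r) f"
    using assms(3) analytic_imp_holomorphic holomorphic_on_imp_continuous_on by blast
  hence "bounded (f ` tube T r)"
    using compact_continuous_image compact_tube[OF assms(1,2)] compact_imp_bounded by blast
  then obtain C where C: "C > 0" "\<And>z. z \<in> tube T r \<Longrightarrow> norm (f z) \<le> C"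
    unfolding bounded_pos by blast
  show thesis
  proof (rule that)
    \<comment> \<open>Cauchy's inequality gives the ratio 1 / r; the maximum with 1 keeps the powers
      of \<open>M\<close> increasing in the exponent.\<close>
    show "C \<ge> 0" "max 1 (1 / r) \<ge> 1" using C by simp_all
    fix j s assume s: "s \<in> {0..T}"
    note sub = cball_subset_tube[OF s, of r]
    have hol: "f holomorphic_on cball (of_real s) r"
      using assms(3) analytic_imp_holomorphic holomorphic_on_subset sub by blast
    have "norm ((deriv ^^ j) f (of_real s)) \<le> fact j * C / r ^ j"
    proof (rule Cauchy_inequality)
      show "f holomorphic_on ball (of_real s) r" using hol holomorphic_on_subset ball_subset_cball by blast
      show "continuous_on (cball (of_real s) r) f" using hol by (rule holomorphic_on_imp_continuous_on)
      fix z assume "norm (complex_of_real s - z) = r"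
      hence "z \<in> cball (of_real s) r" by (simp add: dist_norm)
      thus "norm (f z) \<le> C" using C sub by blast
    qed fact
    also have "\<dots> = C * fact j * (1 / r) ^ j" by (simp add: power_divide)
    also have "\<dots> \<le> C * fact j * max 1 (1 / r) ^ j"
      using C(1) assms(2) by (intro mult_left_mono power_mono) auto
    finally show "norm ((deriv ^^ j) f (of_real s)) \<le> C * fact j * max 1 (1 / r) ^ j" .
  qed
qed

lemma higher_deriv_has_vector_derivative:
  assumes "f analytic_on S" "of_real s \<in> S"
  shows "((\<lambda>s. (deriv ^^ j) f (of_real s)) has_vector_derivative (deriv ^^ Suc j) f (of_real s)) (at s within A)"
proof (rule has_vector_derivative_real_field)
  have "(deriv ^^ j) f analytic_on S" using assms(1) by (rule analytic_higher_deriv)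
  hence "(deriv ^^ j) f field_differentiable at (of_real s)"
    using assms(2) analytic_on_imp_differentiable_at by blast
  thus "((deriv ^^ j) f has_field_derivative (deriv ^^ Suc j) f (of_real s)) (at (of_real s))"
    by (simp add: DERIV_deriv_iff_field_differentiable)
qed

section \<open>Moving derivatives from the kernel to the datum\<close>

lemma fact_mult_fact_le: "fact m * fact n \<le> (fact (m + n) :: real)"
proof -
  have "fact m * fact n \<le> (fact (m + n) :: nat)" by (intro dvd_imp_le fact_fact_dvd_fact) simp
  hence "real (fact m * fact n) \<le> real (fact (m + n))" by (simp only: of_nat_le_iff)
  thus ?thesis by simp
qed

text \<open>By the chain rule, K_n(t - s) has s-derivative K_(n+1)(t - s), so each integration by
  parts lowers the index of \<open>K\<close> and raises that of \<open>F\<close>. Boundary terms at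
  s = t vanish by \<open>K0\<close>, and those at s = 0 involve \<open>K\<close> at time
  \<open>t\<close> only; hence growth in \<open>n\<close> has to be controlled only there.\<close>

lemma iterated_integration_by_parts_bound:
  fixes F K :: "nat \<Rightarrow> real \<Rightarrow> complex"
  assumes "t \<ge> 0" and M: "M \<ge> 1" and C: "C\<^sub>1 \<ge> 0" "C\<^sub>2 \<ge> 0"
    and F: "\<And>j s. s \<in> {0..t} \<Longrightarrow> (F j has_vector_derivative F (Suc j) s) (at s within {0..t})"
    and K: "\<And>n s. s \<in> {0..t} \<Longrightarrow> (K n has_vector_derivative - K (Suc n) s) (at s within {0..t})"
    and K0: "\<And>n. K n 0 = 0"
    and F_bound: "\<And>j s. s \<in> {0..t} \<Longrightarrow> norm (F j s) \<le> C\<^sub>1 * fact j * M ^ j"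
    and K_bound: "\<And>n. norm (K n t) \<le> C\<^sub>2 * fact n * M ^ n"
  obtains C where "C \<ge> 0"
    "\<And>n. norm (integral {0..t} (\<lambda>s. F 0 s * K n (t - s))) \<le> C * (real n + 1) * fact n * M ^ n"
proof -
  have contF: "continuous_on {0..t} (F j)" for j
    using F by (rule continuous_on_vector_derivative)
  have contK: "continuous_on {0..t} (K n)" for n
    using K by (rule continuous_on_vector_derivative)
  have contK': "continuous_on {0..t} (\<lambda>s. K n (t - s))" for n
    by (rule continuous_on_compose2[OF contK]) (auto intro!: continuous_intros)
  have int: "(\<lambda>s. F j s * K n (t - s)) integrable_on {0..t}" for j n
    by (intro integrable_continuous_real continuous_on_mult contF contK')
  have parts: "integral {0..t} (\<lambda>s. F j s * K (Suc n) (t - s)) =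
    - F j 0 * K n t - integral {0..t} (\<lambda>s. F (Suc j) s * K n (t - s))" for j n
  proof -
    have "((\<lambda>s. F j s * K (Suc n) (t - s) + F (Suc j) s * K n (t - s)) has_integral
        (F j t * K n (t - t) - F j 0 * K n (t - 0))) {0..t}"
    proof (rule fundamental_theorem_of_calculus[OF assms(1)])
      fix s assume s: "s \<in> {0..t}"
      have "((\<lambda>s. t - s) has_vector_derivative - 1) (at s within {0..t})"
        by (auto intro!: derivative_eq_intros)
      moreover have "(K n has_vector_derivative - K (Suc n) (t - s)) (at (t - s) within (\<lambda>s. t - s) ` {0..t})"
        using K[of "t - s" n] s by (simp add: image_minus_const_atLeastAtMost')
      ultimately have "((\<lambda>s. K n (t - s)) has_vector_derivative K (Suc n) (t - s)) (at s within {0..t})"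
        using vector_diff_chain_within[of "\<lambda>s. t - s" "- 1" s "{0..t}" "K n" "- K (Suc n) (t - s)"]
        by (simp add: o_def)
      from has_vector_derivative_mult[OF F[OF s] this]
      show "((\<lambda>s. F j s * K n (t - s)) has_vector_derivative
        F j s * K (Suc n) (t - s) + F (Suc j) s * K n (t - s)) (at s within {0..t})" by simp
    qed
    moreover have "((\<lambda>s. F j s * K (Suc n) (t - s) + F (Suc j) s * K n (t - s)) has_integral
        integral {0..t} (\<lambda>s. F j s * K (Suc n) (t - s)) + integral {0..t} (\<lambda>s. F (Suc j) s * K n (t - s))) {0..t}"
      by (intro has_integral_add integrable_integral int)
    ultimately have "integral {0..t} (\<lambda>s. F j s * K (Suc n) (t - s)) + integral {0..t} (\<lambda>s. F (Suc j) s * K n (t - s))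
       = F j t * K n (t - t) - F j 0 * K n (t - 0)"
      by (rule has_integral_unique[symmetric])
    thus ?thesis by (simp add: K0 algebra_simps)
  qed
  \<comment> \<open>When all derivatives have moved to \<open>F\<close>, only \<open>K 0\<close> is
    left under the integral, and continuity is enough to bound it.\<close>
  have "bounded (K 0 ` {0..t})"
    by (intro compact_imp_bounded compact_continuous_image contK) simp
  then obtain D where D: "D > 0" "\<And>s. s \<in> {0..t} \<Longrightarrow> norm (K 0 s) \<le> D"
    unfolding bounded_pos by blast
  define C where "C = C\<^sub>1 * C\<^sub>2 + C\<^sub>1 * D * t"
  have C0: "C \<ge> 0" "C\<^sub>1 * C\<^sub>2 \<le> C" "C\<^sub>1 * D * t \<le> C"
    using assms(1) C D(1) by (simp_all add: C_def)
  \<comment> \<open>Each step of the induction moves one derivative from \<open>K\<close> to \<open>F\<close>.\<close>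
  have main: "norm (integral {0..t} (\<lambda>s. F j s * K n (t - s))) \<le> C * (real n + 1) * fact (n + j) * M ^ (n + j)" for n j
  proof (induction n arbitrary: j)
    case 0
    have "norm (integral {0..t} (\<lambda>s. F j s * K 0 (t - s))) \<le> (C\<^sub>1 * fact j * M ^ j * D) * (t - 0)"
    proof (rule integral_bound[OF assms(1)])
      show "continuous_on {0..t} (\<lambda>s. F j s * K 0 (t - s))" by (intro continuous_on_mult contF contK')
      fix s assume s: "s \<in> {0..t}"
      show "norm (F j s * K 0 (t - s)) \<le> C\<^sub>1 * fact j * M ^ j * D"
        unfolding norm_mult using s C M by (intro mult_mono F_bound D) auto
    qed
    also have "\<dots> = (C\<^sub>1 * D * t) * fact j * M ^ j" by simp
    also have "\<dots> \<le> C * fact j * M ^ j" using M by (intro mult_right_mono C0) auto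
    finally show ?case by simp
  next
    case (Suc n)
    have "norm (integral {0..t} (\<lambda>s. F j s * K (Suc n) (t - s))) \<le>
      norm (F j 0) * norm (K n t) + norm (integral {0..t} (\<lambda>s. F (Suc j) s * K n (t - s)))"
      unfolding parts using norm_triangle_ineq4[of "- F j 0 * K n t"] by (simp add: norm_mult)
    \<comment> \<open>The boundary term has the size of one summand of the claimed bound; the factor
      n + 1 in that bound counts these terms together with the final integral.\<close>
    also have "norm (F j 0) * norm (K n t) \<le> (C\<^sub>1 * fact j * M ^ j) * (C\<^sub>2 * fact n * M ^ n)"
      using assms(1) C M by (intro mult_mono F_bound K_bound) auto
    also have "\<dots> = (C\<^sub>1 * C\<^sub>2) * (fact n * fact j) * M ^ (n + j)" by (simp add: power_add)
    also have "\<dots> \<le> C * fact (Suc n + j) * M ^ (Suc n + j)"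
    proof (intro mult_mono C0)
      have "fact (n + j) \<le> (fact (Suc n + j) :: real)" by (intro fact_mono) simp
      with fact_mult_fact_le[of n j] show "fact n * fact j \<le> (fact (Suc n + j) :: real)" by (rule order.trans)
      show "M ^ (n + j) \<le> M ^ (Suc n + j)" using M by (intro power_increasing) auto
    qed (use C0 M in auto)
    also have "norm (integral {0..t} (\<lambda>s. F (Suc j) s * K n (t - s))) \<le>
      C * (real n + 1) * fact (Suc n + j) * M ^ (Suc n + j)"
      using Suc.IH[of "Suc j"] by simp
    also have "C * fact (Suc n + j) * M ^ (Suc n + j) + C * (real n + 1) * fact (Suc n + j) * M ^ (Suc n + j)
      = C * (real (Suc n) + 1) * fact (Suc n + j) * M ^ (Suc n + j)"
      by (simp only: of_nat_Suc algebra_simps)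
    finally show ?case by simp
  qed
  show thesis
    by (rule that[OF C0(1)]) (use main[of 0] in simp)
qed

section \<open>Coefficient bounds and the entire series\<close>

lemma odd_power_series_entire:
  fixes a :: "nat \<Rightarrow> complex" and c :: complex
  assumes a: "\<And>n. norm (a n) \<le> C * q ^ n / fact n"
  shows "summable (\<lambda>n. a n * (x - c) ^ (2 * Suc n - 1))"
    and "(\<lambda>x. \<Sum>n. a n * (x - c) ^ (2 * Suc n - 1)) holomorphic_on UNIV"
proof -
  have sum: "summable (\<lambda>n. a n * y ^ n)" for y
  proof (rule summable_comparison_test')
    show "summable (\<lambda>n. C * ((q * norm y) ^ n /\<^sub>R fact n))"
      by (intro summable_mult summable_exp_generic)
    fix n
    have "norm (a n * y ^ n) \<le> (C * q ^ n / fact n) * norm y ^ n"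
      unfolding norm_mult norm_power by (intro mult_right_mono a) simp
    thus "norm (a n * y ^ n) \<le> C * ((q * norm y) ^ n /\<^sub>R fact n)"
      by (simp add: power_mult_distrib field_simps)
  qed
  \<comment> \<open>The exponent is 2n + 1, so the series is (x - c) times a power series in (x -
    c)^2 whose coefficients are dominated by those of an exponential series.\<close>
  have eq: "a n * (x - c) ^ (2 * Suc n - 1) = (x - c) * (a n * ((x - c)\<^sup>2) ^ n)" for n x
    by (simp add: mult_ac flip: power_mult)
  show "summable (\<lambda>n. a n * (x - c) ^ (2 * Suc n - 1))"
    unfolding eq by (intro summable_mult sum)
  have "(\<lambda>y. \<Sum>n. a n * y ^ n) holomorphic_on UNIV"
    using termdiffs_strong_converges_everywhere[OF sum]
    unfolding holomorphic_on_def field_differentiable_def by blast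
  from holomorphic_on_compose_gen[OF _ this, of "\<lambda>x. (x - c)\<^sup>2" UNIV]
  have "(\<lambda>x. \<Sum>n. a n * ((x - c)\<^sup>2) ^ n) holomorphic_on UNIV"
    by (simp add: o_def holomorphic_intros)
  hence "(\<lambda>x. (x - c) * (\<Sum>n. a n * ((x - c)\<^sup>2) ^ n)) holomorphic_on UNIV"
    by (intro holomorphic_intros)
  thus "(\<lambda>x. \<Sum>n. a n * (x - c) ^ (2 * Suc n - 1)) holomorphic_on UNIV"
    unfolding eq by (simp add: suminf_mult[OF sum])
qed

text \<open>Passes from the Lebesgue integral to the gauge integral used for integration by parts.
  They agree because the integrand is continuous on all of [0, t], also at s = t, where the kernel
  is evaluated at time 0.\<close>

lemma coeff_A_eq_integral:
  assumes "L > 0" "R > 0" "t \<ge> 0" and cont: "continuous_on {0..t} (\<lambda>s. f (of_real s))"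
  shows "coeff_A L R f n t = 2 * (- 1) ^ n / (of_real pi * fact (2 * n - 1)) *
    integral {0..t} (\<lambda>s. f (of_real s) * bdOmega_kernel L R n (t - s))"
proof -
  have "continuous_on {0..t} (bdOmega_kernel L R n)"
    using bdOmega_kernel_has_vector_derivative[OF assms(1,2)] by (rule continuous_on_vector_derivative)
  hence "continuous_on {0..t} (\<lambda>s. bdOmega_kernel L R n (t - s))"
    by (rule continuous_on_compose2) (auto intro!: continuous_intros)
  hence "set_integrable lborel {0..t} (\<lambda>s. f (of_real s) * bdOmega_kernel L R n (t - s))"
    by (intro borel_integrable_atLeastAtMost' continuous_on_mult cont)
  from set_borel_integral_eq_integral(2)[OF this] show ?thesis
    unfolding coeff_A_def bdOmega_kernel_def heat_kernel_def by simp
qed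

text \<open>The factorial growth of the time integral is beaten by (2n + 1)!, since (n + 1)! / (2n +
  1)! \<le> 1 / n!.\<close>

lemma coeff_A_bound:
  assumes "L > 0" "R > 0" "r > 0" "0 \<le> t" "t \<le> T" and f: "f analytic_on tube T r"
  obtains C q where "\<And>n. norm (coeff_A L R f (Suc n) t) \<le> C * q ^ n / fact n"
proof -
  let ?K = "bdOmega_kernel L R"
  define F where "F = (\<lambda>j s. (deriv ^^ j) f (of_real s))"
  have mem: "of_real s \<in> tube T r" if "s \<in> {0..t}" for s
    using cball_subset_tube[of s T r] that assms by auto
  have F: "(F j has_vector_derivative F (Suc j) s) (at s within {0..t})" if "s \<in> {0..t}" for j s
    unfolding F_def by (rule higher_deriv_has_vector_derivative[OF f mem[OF that]])
  have "continuous_on {0..t} (F 0)" using F by (rule continuous_on_vector_derivative)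
  hence eq: "coeff_A L R f n t = 2 * (- 1) ^ n / (of_real pi * fact (2 * n - 1)) *
      integral {0..t} (\<lambda>s. F 0 s * ?K n (t - s))" for n
    using coeff_A_eq_integral[OF assms(1,2,4)] by (simp add: F_def)
  show thesis
  \<comment> \<open>The kernel bound requires t > 0; at t = 0 the integral is over a single
    point.\<close>
  proof (cases "t = 0")
    case True
    hence "coeff_A L R f n t = 0" for n unfolding eq by simp
    thus thesis by (intro that[of 0 0]) (simp only:, simp)
  next
    case False
    hence t: "t > 0" using assms by simp
    obtain C\<^sub>1 M\<^sub>1 where 1: "C\<^sub>1 \<ge> 0" "M\<^sub>1 \<ge> 1"
      "\<And>j s. s \<in> {0..T} \<Longrightarrow> norm ((deriv ^^ j) f (of_real s)) \<le> C\<^sub>1 * fact j * M\<^sub>1 ^ j"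
      using higher_deriv_tube_bound[OF _ assms(3) f] t assms(5) by (metis less_le_trans order_less_imp_le)
    obtain C\<^sub>2 M\<^sub>2 where 2: "C\<^sub>2 \<ge> 0" "M\<^sub>2 \<ge> 1" "\<And>n. norm (?K n t) \<le> C\<^sub>2 * fact n * M\<^sub>2 ^ n"
      using bdOmega_kernel_bound[OF assms(1,2) t] by blast
    define M where "M = max M\<^sub>1 M\<^sub>2"
    have M: "M \<ge> 1" using 1 by (simp add: M_def)
    obtain C where C: "C \<ge> 0"
      "\<And>n. norm (integral {0..t} (\<lambda>s. F 0 s * ?K n (t - s))) \<le> C * (real n + 1) * fact n * M ^ n"
    proof (rule iterated_integration_by_parts_bound[of t M C\<^sub>1 C\<^sub>2 F ?K])
      show "(?K n has_vector_derivative - ?K (Suc n) s) (at s within {0..t})" if "s \<in> {0..t}" for n s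
        using bdOmega_kernel_has_vector_derivative[OF assms(1,2) that] .
      show "norm (F j s) \<le> C\<^sub>1 * fact j * M ^ j" if "s \<in> {0..t}" for j s
      proof -
        have "norm (F j s) \<le> C\<^sub>1 * fact j * M\<^sub>1 ^ j" unfolding F_def using that assms by (intro 1) auto
        also have "\<dots> \<le> C\<^sub>1 * fact j * M ^ j" using 1 by (intro mult_left_mono power_mono) (auto simp: M_def)
        finally show ?thesis .
      qed
      show "norm (?K n t) \<le> C\<^sub>2 * fact n * M ^ n" for n
      proof -
        have "C\<^sub>2 * fact n * M\<^sub>2 ^ n \<le> C\<^sub>2 * fact n * M ^ n"
          using 2 by (intro mult_left_mono power_mono) (auto simp: M_def)
        thus ?thesis using 2(3)[of n] by linarith
      qed
    qed (use assms M 1 2 F bdOmega_kernel_0 in auto)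
    show thesis
    proof (rule that)
      fix n
      have "norm (coeff_A L R f (Suc n) t) \<le> 2 / (pi * fact (2 * n + 1)) * (C * (real (Suc n) + 1) * fact (Suc n) * M ^ Suc n)"
        unfolding eq norm_mult by (intro mult_mono C) (auto simp: norm_divide norm_mult norm_power simp del: fact_Suc)
      also have "\<dots> = 2 / pi * C * M ^ Suc n * ((real n + 2) * (fact (Suc n) / fact (2 * n + 1)))"
        by (simp del: fact_Suc power_Suc)
      also have "\<dots> \<le> 2 / pi * C * M ^ Suc n * ((2 * 2 ^ n) * (1 / fact n))"
      proof (intro mult_left_mono mult_mono)
        \<comment> \<open>The linear factor is absorbed into the geometric one, which turns the
          ratio \<open>M\<close> into \<open>2 * M\<close>.\<close>
        show "real n + 2 \<le> 2 * 2 ^ n" by (induction n) auto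
        have "fact (Suc n) * fact n \<le> (fact (2 * n + 1) :: real)"
        proof -
          have "Suc n + n = 2 * n + 1" by simp
          thus ?thesis using fact_mult_fact_le[of "Suc n" n] by (simp only:)
        qed
        thus "fact (Suc n) / fact (2 * n + 1) \<le> (1 / fact n :: real)"
        proof -
          have "x / y \<le> 1 / z" if "x * z \<le> y" "y > 0" "z > 0" for x y z :: real
            using that by (simp add: field_simps)
          thus ?thesis using \<open>_ \<le> fact (2 * n + 1)\<close> by (simp only: fact_gt_zero)
        qed
      qed (use C M in \<open>auto simp del: fact_Suc\<close>)
      also have "\<dots> = (4 * C * M / pi) * (2 * M) ^ n / fact n"
        by (simp add: power_mult_distrib)
      finally show "norm (coeff_A L R f (Suc n) t) \<le> (4 * C * M / pi) * (2 * M) ^ n / fact n" .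
    qed
  qed
qed

theorem theorem4:
  fixes L R T r :: real and f\<^sub>0 :: "complex \<Rightarrow> complex"
  assumes "L > 0" and "R > 0" and "T > 0" and "r > 0"
    and "f\<^sub>0 analytic_on tube T r"
  shows "\<forall>t\<in>{0..T}.
    (\<forall>x::complex. summable (\<lambda>n. coeff_A L R f\<^sub>0 (Suc n) t * (x - of_real L) ^ (2 * Suc n - 1))) \<and>
    (\<lambda>x::complex. \<Sum>n. coeff_A L R f\<^sub>0 (Suc n) t * (x - of_real L) ^ (2 * Suc n - 1))
      holomorphic_on UNIV"
proof
  fix t assume "t \<in> {0..T}"
  \<comment> \<open>The constants may depend on \<open>t\<close>, which is fixed here.\<close>
  then obtain C q where "\<And>n. norm (coeff_A L R f\<^sub>0 (Suc n) t) \<le> C * q ^ n / fact n"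
    using coeff_A_bound[OF assms(1,2,4) _ _ assms(5)] by (metis atLeastAtMost_iff)
  from odd_power_series_entire[OF this]
  show "(\<forall>x::complex. summable (\<lambda>n. coeff_A L R f\<^sub>0 (Suc n) t * (x - of_real L) ^ (2 * Suc n - 1))) \<and>
    (\<lambda>x::complex. \<Sum>n. coeff_A L R f\<^sub>0 (Suc n) t * (x - of_real L) ^ (2 * Suc n - 1))
      holomorphic_on UNIV" by blast
qed

end
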